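(* Let $a\in L^1(I)$. For every $\lambda<\lambda_0^N$ and all $(t,s)\in(0,1]\times(0,1]$, $$G_N[\lambda](t,s)<G_{M_2}[\lambda](t,s)<0.$$
   Context: $I=[0,1]$, $a\in L^1(I)$ is real-valued, $\lambda\in\mathbb{R}$, and $L[\lambda]u(t)=u''(t)+(a(t)+\lambda)u(t)$. $W^{2,1}(I)=\{u\in C(I):u'\in AC(I)\}$, where $AC(I)$ is the set of absolutely continuous functions on $I$. $X_N=\{u\in W^{2,1}(I):u'(0)=u'(1)=0\}$ (Neumann) and $X_{M_2}=\{u\in W^{2,1}(I):u(0)=u'(1)=0\}$ (Mixed 2). $L[\lambda]$ is nonresonant in $X$ if $u=0$ is the only $u\in X$ with $L[\lambda]u=0$ a.e. on $I$. In that case, for every $\sigma\in L^1(I)$ the problem $L[\lambda]u=\sigma$ a.e. on $I$, $u\in X$, has a unique solution, given by $u(t)=\int_0^1G(t,s)\sigma(s)\,ds$, where the continuous function $G:I\times I\to\mathbb{R}$ is the Green's function; it is denoted $G_N[\lambda]$ for $X=X_N$ and $G_{M_2}[\lambda]$ for $X=X_{M_2}$. $\lambda_0^N$ and $\lambda_0^{M_2}$ denote the first (smallest) eigenvalues of the Neumann and Mixed 2 problems, i.e. the smallest $\lambda$ for which $L[\lambda]u=0$ a.e. has a nontrivial solution in $X_N$, respectively $X_{M_2}$. It is known that $\lambda_0^N<\lambda_0^{M_2}$, so both Green's functions exist for $\lambda<\lambda_0^N$. *)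

theory Defs
  imports "HOL-Analysis.Analysis"
begin

abbreviation I01 :: "real set" where
  "I01 \<equiv> {0..1}"

text \<open>Absolute continuity of a function. The constant \<open>absolutely_continuous\<close> of
  HOL-Analysis is the unrelated notion for measures. The sets in a division are nonempty compact
  intervals with pairwise disjoint interiors, so \<open>Inf k\<close> and \<open>Sup k\<close> are their endpoints.\<close>

definition AC_on :: "real set \<Rightarrow> (real \<Rightarrow> real) \<Rightarrow> bool" where
  "AC_on S f \<longleftrightarrow>
     (\<forall>\<epsilon>>0. \<exists>\<delta>>0. \<forall>d. d division_of \<Union>d \<and> \<Union>d \<subseteq> S \<and> (\<Sum>k\<in>d. Sup k - Inf k) < \<delta>
        \<longrightarrow> (\<Sum>k\<in>d. \<bar>f (Sup k) - f (Inf k)\<bar>) < \<epsilon>)"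

text \<open>Functions on \<open>[0,1]\<close> are represented by functions on \<open>real\<close> of which only the values on
  \<open>[0,1]\<close> matter. The derivative is taken within \<open>[0,1]\<close>, hence is one-sided at the endpoints.\<close>

definition deriv_I :: "(real \<Rightarrow> real) \<Rightarrow> real \<Rightarrow> real" where
  "deriv_I u t = vector_derivative u (at t within I01)"

definition W21 :: "(real \<Rightarrow> real) set" where
  "W21 = {u. continuous_on I01 u \<and> u differentiable_on I01 \<and> AC_on I01 (deriv_I u)}"

definition X_N :: "(real \<Rightarrow> real) set" where
  "X_N = {u \<in> W21. deriv_I u 0 = 0 \<and> deriv_I u 1 = 0}"

definition X_M2 :: "(real \<Rightarrow> real) set" where
  "X_M2 = {u \<in> W21. u 0 = 0 \<and> deriv_I u 1 = 0}"

definition L_op :: "(real \<Rightarrow> real) \<Rightarrow> real \<Rightarrow> (real \<Rightarrow> real) \<Rightarrow> real \<Rightarrow> real" where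
  "L_op a lam u t = deriv_I (deriv_I u) t + (a t + lam) * u t"

text \<open>\<open>vector_derivative\<close> is total, so the existence of \<open>u''(t)\<close> is required explicitly at the
  points where the equation is said to hold. For \<open>u \<in> W21\<close> this is automatic almost everywhere.\<close>

definition solves_ae ::
  "(real \<Rightarrow> real) \<Rightarrow> real \<Rightarrow> (real \<Rightarrow> real) \<Rightarrow> (real \<Rightarrow> real) \<Rightarrow> bool" where
  "solves_ae a lam \<sigma> u \<longleftrightarrow>
     (AE t in lebesgue_on I01. deriv_I u differentiable (at t within I01) \<and> L_op a lam u t = \<sigma> t)"

definition nonresonant :: "(real \<Rightarrow> real) \<Rightarrow> (real \<Rightarrow> real) set \<Rightarrow> real \<Rightarrow> bool" where
  "nonresonant a X lam \<longleftrightarrow> (\<forall>u\<in>X. solves_ae a lam (\<lambda>_. 0) u \<longrightarrow> (\<forall>t\<in>I01. u t = 0))"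

definition is_eigenvalue :: "(real \<Rightarrow> real) \<Rightarrow> (real \<Rightarrow> real) set \<Rightarrow> real \<Rightarrow> bool" where
  "is_eigenvalue a X lam \<longleftrightarrow> (\<exists>u\<in>X. solves_ae a lam (\<lambda>_. 0) u \<and> (\<exists>t\<in>I01. u t \<noteq> 0))"

definition is_first_eigenvalue :: "(real \<Rightarrow> real) \<Rightarrow> (real \<Rightarrow> real) set \<Rightarrow> real \<Rightarrow> bool" where
  "is_first_eigenvalue a X lam0 \<longleftrightarrow>
     is_eigenvalue a X lam0 \<and> (\<forall>lam. is_eigenvalue a X lam \<longrightarrow> lam0 \<le> lam)"

text \<open>By continuity, these conditions determine \<open>G\<close> on \<open>[0,1] \<times> [0,1]\<close>.\<close>

definition is_greens_function ::
  "(real \<Rightarrow> real) \<Rightarrow> (real \<Rightarrow> real) set \<Rightarrow> real \<Rightarrow> (real \<Rightarrow> real \<Rightarrow> real) \<Rightarrow> bool" where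
  "is_greens_function a X lam G \<longleftrightarrow>
     nonresonant a X lam \<and>
     continuous_on (I01 \<times> I01) (\<lambda>(t, s). G t s) \<and>
     (\<forall>\<sigma>. \<sigma> absolutely_integrable_on I01 \<longrightarrow>
        (\<lambda>t. LINT s:I01|lebesgue. G t s * \<sigma> s) \<in> X \<and>
        solves_ae a lam \<sigma> (\<lambda>t. LINT s:I01|lebesgue. G t s * \<sigma> s))"

end

theory Submission
  imports Defs
begin

text \<open>Let \<open>q = a + lam\<close>, and let \<open>\<phi>\<close>, \<open>\<psi>\<close> solve \<open>u'' + q u = 0\<close> with \<open>\<phi>(0) = 1\<close>, \<open>\<phi>'(0) = 0\<close> and
  \<open>\<psi>(0) = 0\<close>, \<open>\<psi>'(0) = 1\<close>. Their Wronskian is \<open>1\<close>, and \<open>v = \<psi>'(1) \<phi> - \<phi>'(1) \<psi>\<close> is the solution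
  with \<open>v(1) = 1\<close>, \<open>v'(1) = 0\<close>. With \<open>m = min s t\<close> and \<open>n = max s t\<close>, the Green's functions are
  \<open>G_N = - v(n) \<phi>(m) / \<phi>'(1)\<close> and \<open>G_M2 = - v(n) \<psi>(m) / \<psi>'(1)\<close> (\<open>greens_function_eq\<close>). Hence
  \<open>G_M2 - G_N = v(n) v(m) / (\<phi>'(1) \<psi>'(1))\<close>, and it suffices that \<open>\<phi>\<close>, \<open>v\<close>, \<open>\<phi>'(1)\<close>, \<open>\<psi>'(1)\<close> are
  positive and \<open>\<psi>\<close> is positive on \<open>(0,1]\<close>. All of this follows from \<open>\<phi> > 0\<close> and \<open>\<phi>'(1) > 0\<close>, because
  \<open>(\<psi>/\<phi>)' = 1/\<phi>\<^sup>2\<close> and \<open>(v/\<phi>)' = - \<phi>'(1)/\<phi>\<^sup>2\<close>.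

  The positivity of \<open>\<phi>\<close> and \<open>\<phi>'(1)\<close> is where the first eigenvalue enters. Both hold when the
  spectral parameter \<open>l\<close> is very negative (\<open>positive_for_very_negative_parameter\<close>). As \<open>l\<close>
  increases to \<open>lam\<close>, \<open>\<phi>'(1)\<close> cannot vanish, since \<open>l\<close> would be a Neumann eigenvalue below the first
  one (\<open>eigenvalue_of_neumann_solution\<close>), and as long as \<open>\<phi>'(1) > 0\<close> the function \<open>\<phi>\<close> cannot acquire
  a first zero (\<open>positivity_continuation\<close>).

  The potential is only integrable. With \<open>B = \<integral> a\<close> and the quasi-derivative \<open>y = u' + B u\<close> the equation
  becomes a system with continuous coefficients, to which classical theory applies (\<open>lin_sys\<close>,
  \<open>lin_sys_of_solves_ae\<close>); the passage rests on the fundamental theorem of calculus for absolutely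
  continuous functions (\<open>AC_on_has_integral\<close>). Solutions depending continuously on \<open>l\<close> come from a
  parametrized Picard--Lindeloef theorem (\<open>picard_lindeloef_param\<close>).\<close>

section \<open>Absolutely continuous functions\<close>

lemma negligible_open_cover_real:
  fixes N :: "real set"
  assumes "negligible N" "0 < \<delta>"
  obtains U where "open U" "N \<subseteq> U" "U \<in> lmeasurable" "measure lebesgue U < \<delta>"
proof -
  have N: "N \<in> lmeasurable" "measure lebesgue N = 0"
    using assms(1) by (simp_all add: negligible_imp_measurable negligible_imp_measure0)
  then have "N \<in> sets lebesgue" by (simp add: fmeasurableD)
  from sets_lebesgue_outer_open[OF this assms(2)]
  obtain U where U: "open U" "N \<subseteq> U" "U - N \<in> lmeasurable" "emeasure lebesgue (U - N) < ennreal \<delta>"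
    by metis
  have "U = (U - N) \<union> N" using U(2) by auto
  then have Um: "U \<in> lmeasurable" using U(3) N(1) by (metis fmeasurable.Un)
  have "measure lebesgue (U - N) < \<delta>"
    using U(3,4) assms(2) by (simp add: emeasure_eq_measure2 ennreal_less_iff)
  moreover have "measure lebesgue (U - N) = measure lebesgue U"
    using assms(1) Um by (simp add: fmeasurableD measure_Diff_null_set negligible_iff_null_sets)
  ultimately show ?thesis using that U(1,2) Um by simp
qed

text \<open>The derivative of \<open>g\<close> at \<open>x\<close> controls the increment of \<open>g\<close> over an interval \<open>[u,v]\<close> that
  contains \<open>x\<close> (not only over intervals starting at \<open>x\<close>), which is what tagged divisions need.\<close>

lemma straddle_real:
  fixes g :: "real \<Rightarrow> real"
  assumes "\<bar>g u - g x - (u - x) * c\<bar> \<le> e * \<bar>u - x\<bar>"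
    and "\<bar>g v - g x - (v - x) * c\<bar> \<le> e * \<bar>v - x\<bar>"
    and "u \<le> x" "x \<le> v"
  shows "\<bar>(v - u) * c - (g v - g u)\<bar> \<le> e * (v - u)"
proof -
  have "\<bar>(v - u) * c - (g v - g u)\<bar> = \<bar>(g u - g x - (u - x) * c) - (g v - g x - (v - x) * c)\<bar>"
    by (simp add: algebra_simps)
  also have "\<dots> \<le> e * \<bar>u - x\<bar> + e * \<bar>v - x\<bar>"
    using assms(1,2) by linarith
  also have "\<dots> = e * (v - u)"
    using assms(3,4) by (simp add: algebra_simps)
  finally show ?thesis .
qed

text \<open>The fundamental theorem of calculus for absolutely continuous functions. In a Riemann sum for a
  sufficiently fine gauge, the terms with tag outside \<open>N\<close> are controlled by the derivative. The
  gauge makes the intervals with tag in \<open>N\<close> lie in an open set of small measure, so absolute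
  continuity makes the increments of \<open>g\<close> over them small.\<close>

theorem AC_on_has_integral:
  fixes f g :: "real \<Rightarrow> real"
  assumes AC: "AC_on S g" and S: "{a..b} \<subseteq> S" and ab: "a \<le> b" and N: "negligible N"
    and der: "\<And>x. x \<in> {a..b} - N \<Longrightarrow> (g has_real_derivative f x) (at x within {a..b})"
  shows "(f has_integral (g b - g a)) {a..b}"
proof -
  \<comment> \<open>The values of \<open>f\<close> on \<open>N\<close> are arbitrary; setting them to \<open>0\<close> removes them from the Riemann sums.\<close>
  define f0 where "f0 = (\<lambda>x. if x \<in> N then 0 else f x)"
  have "(f0 has_integral (g b - g a)) {a..b}"
    unfolding has_integral_real
  proof (intro allI impI)
    fix e :: real assume e: "0 < e"
    define \<eta> where "\<eta> = e / (2 * (b - a + 1))"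
    have \<eta>: "0 < \<eta>" and \<eta>2: "\<eta> * (b - a) < e / 2"
      using e ab by (auto simp: \<eta>_def field_simps)
    from AC e obtain \<delta> where \<delta>: "0 < \<delta>" and
      \<delta>AC: "\<And>d. d division_of \<Union>d \<Longrightarrow> \<Union>d \<subseteq> S \<Longrightarrow> (\<Sum>k\<in>d. Sup k - Inf k) < \<delta>
        \<Longrightarrow> (\<Sum>k\<in>d. \<bar>g (Sup k) - g (Inf k)\<bar>) < e / 2"
      unfolding AC_on_def by (meson half_gt_zero)
    obtain U where U: "open U" "N \<subseteq> U" "U \<in> lmeasurable" "measure lebesgue U < \<delta>"
      using negligible_open_cover_real[OF N \<delta>] by blast
    have "\<exists>r>0. \<forall>y\<in>{a..b}. \<bar>y - x\<bar> < r \<longrightarrow> \<bar>g y - g x - (y - x) * f x\<bar> \<le> \<eta> * \<bar>y - x\<bar>"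
      if "x \<in> {a..b} - N" for x
      using der[OF that] \<eta>
      unfolding has_field_derivative_def has_derivative_within_alt
      by (auto simp: mult.commute)
    then obtain r where r: "\<And>x. x \<in> {a..b} - N \<Longrightarrow> 0 < r x"
      and rd: "\<And>x y. x \<in> {a..b} - N \<Longrightarrow> y \<in> {a..b} \<Longrightarrow> \<bar>y - x\<bar> < r x \<Longrightarrow>
          \<bar>g y - g x - (y - x) * f x\<bar> \<le> \<eta> * \<bar>y - x\<bar>"
      by metis
    define \<gamma> where "\<gamma> = (\<lambda>x. if x \<in> N then U else if x \<in> {a..b} then ball x (r x) else UNIV)"
    have "gauge \<gamma>"
      unfolding gauge_def \<gamma>_def using U(1,2) r by auto
    moreover have "norm ((\<Sum>(x, k)\<in>p. measure lborel k *\<^sub>R f0 x) - (g b - g a)) < e"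
      if p: "p tagged_division_of {a..b}" and fine: "\<gamma> fine p" for p
    proof -
      note pD = tagged_division_ofD[OF p]
      have fin: "finite p" using pD(1) .
      have K: "\<exists>u v. K = {u..v} \<and> u \<le> x \<and> x \<le> v \<and> {u..v} \<subseteq> {a..b}" if "(x, K) \<in> p" for x K
        using pD(2,3,4)[OF that] by fastforce
      \<comment> \<open>The empty interval needs a case of its own because \<open>Sup {}\<close> and \<open>Inf {}\<close> are unspecified.\<close>
      define J where "J = (\<lambda>K::real set. if K = {} then 0 else \<bar>g (Sup K) - g (Inf K)\<bar>)"
      define pN where "pN = {xk \<in> p. fst xk \<in> N}"
      have pNsub: "pN \<subseteq> p" by (auto simp: pN_def)
      have "pN tagged_partial_division_of {a..b}"
        using p pNsub by (meson tagged_division_of_def tagged_partial_division_subset)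
      then have pNt: "pN tagged_division_of (\<Union>(snd ` pN))"
        by (rule tagged_partial_division_of_Union_self)
      have dN: "snd ` pN division_of \<Union>(snd ` pN)"
        using pNt by (rule division_of_tagged_division)
      have Usub: "\<Union>(snd ` pN) \<subseteq> U"
        using fine by (fastforce simp: pN_def fine_def \<gamma>_def)
      have Ssub: "\<Union>(snd ` pN) \<subseteq> S"
        using pD(3) S pNsub by fastforce
      have len: "Sup K - Inf K = measure lebesgue K" if "K \<in> snd ` pN" for K
        using that K pNsub by fastforce
      have "(\<Sum>K\<in>snd ` pN. Sup K - Inf K) = measure lebesgue (\<Union>(snd ` pN))"
        using len content_division[OF dN] by simp
      also have "\<dots> \<le> measure lebesgue U"
        using Usub U(3) lmeasurable_division[OF dN] by (intro measure_mono_fmeasurable) (auto simp: fmeasurableD)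
      also have "\<dots> < \<delta>" by fact
      finally have "(\<Sum>K\<in>snd ` pN. \<bar>g (Sup K) - g (Inf K)\<bar>) < e / 2"
        using \<delta>AC[OF dN Ssub] by simp
      moreover have "(\<Sum>K\<in>snd ` pN. J K) = (\<Sum>K\<in>snd ` pN. \<bar>g (Sup K) - g (Inf K)\<bar>)"
        using division_ofD(3)[OF dN] by (intro sum.cong) (auto simp: J_def)
      moreover have "(\<Sum>(x, K)\<in>pN. J K) = (\<Sum>K\<in>snd ` pN. J K)"
      proof (rule sum.over_tagged_division_lemma[OF pNt])
        fix u v :: real assume "box u v = {}"
        then show "J (cbox u v) = 0"
          unfolding J_def by (cases "u = v") auto
      qed
      ultimately have bN: "(\<Sum>(x, K)\<in>pN. J K) < e / 2" by simp
      have bp: "(\<Sum>(x, K)\<in>p. \<eta> * measure lborel K) = \<eta> * (b - a)"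
        using additive_content_tagged_division[of p a b] p ab
        by (simp add: sum_distrib_left[symmetric] split_beta)
      have sumJ: "(\<Sum>(x, K)\<in>p. if x \<in> N then J K else 0) = (\<Sum>(x, K)\<in>pN. J K)"
        unfolding pN_def by (rule sum.mono_neutral_cong_right) (use fin in \<open>auto split: if_splits\<close>)
      have "(\<Sum>(x, k)\<in>p. measure lborel k *\<^sub>R f0 x) - (g b - g a)
          = (\<Sum>(x, k)\<in>p. measure lborel k * f0 x - (g (Sup k) - g (Inf k)))"
        using additive_tagged_division_1[OF ab p, of g]
        by (simp add: split_beta sum_subtractf)
      also have "norm \<dots> \<le> (\<Sum>(x, k)\<in>p. \<eta> * measure lborel k + (if x \<in> N then J k else 0))"
      proof (rule sum_norm_le, clarify)
        fix x K assume xK: "(x, K) \<in> p"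
        then obtain u v where uv: "K = {u..v}" "u \<le> x" "x \<le> v" "{u..v} \<subseteq> {a..b}"
          using K by blast
        have SI: "Sup K = v" "Inf K = u" "measure lborel K = v - u" using uv by auto
        show "norm (measure lborel K * f0 x - (g (Sup K) - g (Inf K))) \<le> \<eta> * measure lborel K + (if x \<in> N then J K else 0)"
        proof (cases "x \<in> N")
          case True
          then show ?thesis using uv(1-3) \<eta> by (simp add: f0_def J_def SI abs_minus_commute)
        next
          case False
          have xin: "x \<in> {a..b} - N" using uv False by auto
          have "K \<subseteq> \<gamma> x" using fine xK by (auto simp: fine_def)
          then have sub: "K \<subseteq> ball x (r x)" using xin by (simp add: \<gamma>_def)
          have "u \<in> K" "v \<in> K" using uv by auto
          then have "\<bar>u - x\<bar> < r x" "\<bar>v - x\<bar> < r x"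
            using subsetD[OF sub] by (simp_all add: dist_real_def abs_minus_commute)
          moreover have "u \<in> {a..b}" "v \<in> {a..b}" using uv by auto
          ultimately have "\<bar>(v - u) * f x - (g v - g u)\<bar> \<le> \<eta> * (v - u)"
            using straddle_real[of g u x "f x" \<eta> v] rd[OF xin] uv(2,3) by blast
          then show ?thesis using False by (simp add: f0_def SI)
        qed
      qed
      also have "\<dots> = \<eta> * (b - a) + (\<Sum>(x, K)\<in>pN. J K)"
        using bp sumJ by (simp add: split_beta sum.distrib)
      also have "\<dots> < e" using bN \<eta>2 by linarith
      finally show ?thesis .
    qed
    ultimately show "\<exists>\<gamma>. gauge \<gamma> \<and> (\<forall>p. p tagged_division_of {a..b} \<and> \<gamma> fine p \<longrightarrow>
        norm ((\<Sum>(x, k)\<in>p. measure lborel k *\<^sub>R f0 x) - (g b - g a)) < e)"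
      by (intro exI[of _ \<gamma>] conjI allI impI) (assumption, elim conjE)
  qed
  then show ?thesis
    by (rule has_integral_spike[OF N, rotated]) (simp add: f0_def)
qed

section \<open>Reduction to a system with continuous coefficients\<close>

text \<open>If \<open>B\<close> is an indefinite integral of \<open>a\<close>, then \<open>u'' + (a + l) u = \<sigma>\<close> is equivalent to this
  first-order system for \<open>u\<close> and its quasi-derivative \<open>y = u' + B u\<close>. The merely integrable
  coefficient \<open>a\<close> is replaced by the continuous coefficient \<open>B\<close>, and the parameter \<open>l\<close> enters affinely.\<close>

definition lin_sys ::
  "(real \<Rightarrow> real) \<Rightarrow> real \<Rightarrow> (real \<Rightarrow> real) \<Rightarrow> (real \<Rightarrow> real) \<Rightarrow> (real \<Rightarrow> real) \<Rightarrow> bool" where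
  "lin_sys B l \<sigma> u y \<longleftrightarrow> (\<forall>t\<in>I01.
      (u has_real_derivative y t - B t * u t) (at t within I01) \<and>
      (y has_real_derivative \<sigma> t + B t * y t - ((B t)\<^sup>2 + l) * u t) (at t within I01))"

lemma absolutely_integrable_mult_continuous:
  fixes a u :: "real \<Rightarrow> real"
  assumes "a absolutely_integrable_on {p..q}" "continuous_on {p..q} u"
  shows "(\<lambda>s. a s * u s) absolutely_integrable_on {p..q}"
proof -
  have "(\<lambda>s. u s * a s) absolutely_integrable_on {p..q}"
  proof (rule absolutely_integrable_bounded_measurable_product_real)
    show "u \<in> borel_measurable (lebesgue_on {p..q})"
      using assms(2) by (intro continuous_imp_measurable_on_sets_lebesgue) auto
    show "bounded (u ` {p..q})"
      using assms(2) by (intro compact_imp_bounded compact_continuous_image) auto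
  qed (use assms in auto)
  then show ?thesis by (simp add: mult.commute)
qed

text \<open>Formally \<open>(B u - \<integral> a u)' = a u + B u' - a u = B u'\<close>, where \<open>B = \<integral> a\<close>. The cancellation of
  \<open>a u\<close> makes this true at every point, although \<open>B\<close> itself need not be differentiable there: the
  increment over \<open>[x,y]\<close> is \<open>B(y) (u(y) - u(x)) - \<integral> a(s) (u(s) - u(x)) ds\<close>, where the integral is
  at most a Lipschitz constant of \<open>u\<close> times \<open>(y - x) \<integral> \<bar>a\<bar>\<close>, hence \<open>o(y - x)\<close>.\<close>

lemma has_derivative_indefinite_product:
  fixes a u :: "real \<Rightarrow> real"
  assumes a: "a absolutely_integrable_on {p..q}"
    and der: "\<And>t. t \<in> {p..q} \<Longrightarrow> (u has_real_derivative u' t) (at t within {p..q})"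
    and cont: "continuous_on {p..q} u'" and t: "t \<in> {p..q}"
  shows "((\<lambda>x. integral {p..x} a * u x - integral {p..x} (\<lambda>s. a s * u s))
            has_real_derivative integral {p..t} a * u' t) (at t within {p..q})"
proof -
  define B where "B = (\<lambda>x. integral {p..x} a)"
  define A where "A = (\<lambda>x. integral {p..x} (\<lambda>s. \<bar>a s\<bar>))"
  define Z where "Z = (\<lambda>x. B x * u x - integral {p..x} (\<lambda>s. a s * u s))"
  have contu: "continuous_on {p..q} u"
    using der by (meson DERIV_continuous_on)
  have ai: "a integrable_on {p..q}" and aai: "(\<lambda>s. \<bar>a s\<bar>) integrable_on {p..q}"
    using a set_integrable_abs[OF a] by (auto simp: set_lebesgue_integral_eq_integral(1))
  have aui: "(\<lambda>s. a s * u s) integrable_on {p..q}"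
    using absolutely_integrable_mult_continuous[OF a contu] set_lebesgue_integral_eq_integral(1) by blast
  have "bounded (u' ` {p..q})"
    using cont by (intro compact_imp_bounded compact_continuous_image) auto
  then obtain L where L: "\<And>x. x \<in> {p..q} \<Longrightarrow> \<bar>u' x\<bar> \<le> L"
    unfolding bounded_iff by (metis image_eqI real_norm_def)
  have L0: "0 \<le> L" using L[OF t] by linarith
  have lip: "\<bar>u y - u x\<bar> \<le> L * \<bar>y - x\<bar>" if "x \<in> {p..q}" "y \<in> {p..q}" for x y
    using field_differentiable_bound[of "{p..q}" u u' L y x] der L that by auto
  have split: "integral {p..y} g - integral {p..x} g = integral {x..y} g"
    if "g integrable_on {p..q}" "x \<le> y" "x \<in> {p..q}" "y \<in> {p..q}" for g :: "real \<Rightarrow> real" and x y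
  proof -
    have "g integrable_on {p..y}" using that by (auto intro: integrable_on_subinterval)
    then show ?thesis using Henstock_Kurzweil_Integration.integral_combine[of p x y g] that by auto
  qed
  have est: "\<bar>Z y - Z x - B y * (u y - u x)\<bar> \<le> L * (y - x) * (A y - A x)"
    if xy: "x \<le> y" "x \<in> {p..q}" "y \<in> {p..q}" for x y
  proof -
    have sub: "{x..y} \<subseteq> {p..q}" using xy by auto
    have i1: "a integrable_on {x..y}" "(\<lambda>s. \<bar>a s\<bar>) integrable_on {x..y}" "(\<lambda>s. a s * u s) integrable_on {x..y}"
      using ai aai aui sub by (auto intro: integrable_on_subinterval)
    have i2: "(\<lambda>s. a s * u s - a s * u x) integrable_on {x..y}"
      using i1 by (intro integrable_diff integrable_on_mult_left) auto
    have "Z y - Z x - B y * (u y - u x) = (B y - B x) * u x - integral {x..y} (\<lambda>s. a s * u s)"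
      using split[OF aui xy] by (simp add: Z_def algebra_simps)
    also have "\<dots> = - integral {x..y} (\<lambda>s. a s * u s - a s * u x)"
      using split[OF ai xy] i1 unfolding B_def
      by (subst Henstock_Kurzweil_Integration.integral_diff) (auto intro: integrable_on_mult_left)
    finally have "\<bar>Z y - Z x - B y * (u y - u x)\<bar> = \<bar>integral {x..y} (\<lambda>s. a s * u s - a s * u x)\<bar>"
      by simp
    also have "\<dots> \<le> integral {x..y} (\<lambda>s. L * (y - x) * \<bar>a s\<bar>)"
    proof (rule integral_norm_bound_integral[of "\<lambda>s. a s * u s - a s * u x" "{x..y}"
          "\<lambda>s. L * (y - x) * \<bar>a s\<bar>", unfolded real_norm_def])
      fix s assume s: "s \<in> {x..y}"
      have "\<bar>u s - u x\<bar> \<le> L * \<bar>s - x\<bar>" using lip s sub xy by blast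
      also have "\<dots> \<le> L * (y - x)" using s L0 by (intro mult_left_mono) auto
      finally have "\<bar>a s\<bar> * \<bar>u s - u x\<bar> \<le> \<bar>a s\<bar> * (L * (y - x))"
        by (intro mult_left_mono) auto
      then show "\<bar>a s * u s - a s * u x\<bar> \<le> L * (y - x) * \<bar>a s\<bar>"
        by (simp add: abs_mult[symmetric] algebra_simps)
    qed (use i2 i1 in \<open>auto intro: integrable_on_mult_right\<close>)
    also have "\<dots> = L * (y - x) * (A y - A x)"
      using split[OF aai xy] by (simp add: A_def)
    finally show ?thesis .
  qed
  have est2: "\<bar>Z y - Z t - B t * (u y - u t)\<bar> \<le> L * \<bar>y - t\<bar> * (\<bar>A y - A t\<bar> + \<bar>B y - B t\<bar>)"
    if y: "y \<in> {p..q}" for y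
  proof (cases "t \<le> y")
    case True
    have "\<bar>(B y - B t) * (u y - u t)\<bar> \<le> \<bar>B y - B t\<bar> * (L * \<bar>y - t\<bar>)"
      unfolding abs_mult using lip[OF t y] by (intro mult_left_mono) auto
    moreover have "L * (y - t) * (A y - A t) \<le> L * \<bar>y - t\<bar> * \<bar>A y - A t\<bar>"
      using True L0 by (auto intro!: mult_left_mono)
    moreover have "Z y - Z t - B t * (u y - u t)
        = (Z y - Z t - B y * (u y - u t)) + (B y - B t) * (u y - u t)" by (simp add: algebra_simps)
    ultimately show ?thesis
      using est[OF True t y] by (simp add: algebra_simps) linarith
  next
    case False
    then have "\<bar>Z t - Z y - B t * (u t - u y)\<bar> \<le> L * (t - y) * (A t - A y)"
      using est[of y t] t y by auto
    also have "\<dots> \<le> L * \<bar>y - t\<bar> * (\<bar>A y - A t\<bar> + \<bar>B y - B t\<bar>)"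
      using False L0 by (auto intro!: mult_left_mono)
    finally show ?thesis by (simp add: algebra_simps abs_minus_commute)
  qed
  have contB: "continuous_on {p..q} B" and contA: "continuous_on {p..q} A"
    unfolding B_def A_def using ai aai by (auto intro: indefinite_integral_continuous_1)
  have "((\<lambda>y. L * (\<bar>A y - A t\<bar> + \<bar>B y - B t\<bar>)) \<longlongrightarrow> L * (\<bar>A t - A t\<bar> + \<bar>B t - B t\<bar>)) (at t within {p..q})"
    using contA contB t by (intro tendsto_intros) (auto simp: continuous_on_def)
  then have lim0: "((\<lambda>y. L * (\<bar>A y - A t\<bar> + \<bar>B y - B t\<bar>)) \<longlongrightarrow> 0) (at t within {p..q})" by simp
  have "((\<lambda>y. (Z y - Z t) / (y - t) - B t * ((u y - u t) / (y - t))) \<longlongrightarrow> 0) (at t within {p..q})"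
  proof (rule Lim_null_comparison[OF _ lim0])
    show "\<forall>\<^sub>F y in at t within {p..q}. norm ((Z y - Z t) / (y - t) - B t * ((u y - u t) / (y - t)))
        \<le> L * (\<bar>A y - A t\<bar> + \<bar>B y - B t\<bar>)"
      unfolding eventually_at_filter
    proof (intro always_eventually allI impI)
      fix y assume y: "y \<noteq> t" "y \<in> {p..q}"
      have "(Z y - Z t) / (y - t) - B t * ((u y - u t) / (y - t)) = (Z y - Z t - B t * (u y - u t)) / (y - t)"
        by (simp add: diff_divide_distrib right_diff_distrib)
      then show "norm ((Z y - Z t) / (y - t) - B t * ((u y - u t) / (y - t)))
        \<le> L * (\<bar>A y - A t\<bar> + \<bar>B y - B t\<bar>)"
        using est2[OF y(2)] y(1) by (simp add: abs_divide divide_le_eq mult_ac)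
    qed
  qed
  moreover have "((\<lambda>y. B t * ((u y - u t) / (y - t))) \<longlongrightarrow> B t * u' t) (at t within {p..q})"
    using der[OF t] unfolding has_field_derivative_iff by (intro tendsto_mult tendsto_const)
  ultimately have "((\<lambda>y. (Z y - Z t) / (y - t)) \<longlongrightarrow> 0 + B t * u' t) (at t within {p..q})"
    using tendsto_add by fastforce
  then show ?thesis
    by (simp add: has_field_derivative_iff Z_def B_def)
qed

text \<open>Integrating the equation by the fundamental theorem above shows that \<open>u'\<close> is a constant plus
  \<open>\<integral> (\<sigma> - lam u) - \<integral> a u\<close>. Adding \<open>B u\<close> turns the last integral into the differentiable
  function of the previous lemma. So a solution in the almost everywhere sense is a classical
  solution of the system.\<close>

lemma lin_sys_of_solves_ae:
  assumes a: "a absolutely_integrable_on I01" and u: "u \<in> W21"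
    and sol: "solves_ae a lam \<sigma> u" and \<sigma>: "continuous_on I01 \<sigma>"
  defines "B \<equiv> \<lambda>t. integral {0..t} a"
  shows "lin_sys B lam \<sigma> u (\<lambda>t. deriv_I u t + B t * u t)"
proof -
  have du: "(u has_real_derivative deriv_I u t) (at t within I01)" if "t \<in> I01" for t
    using u that unfolding W21_def deriv_I_def has_real_derivative_iff_has_vector_derivative
    by (auto simp: differentiable_on_def vector_derivative_works[symmetric])
  have contu: "continuous_on I01 u" and AC: "AC_on I01 (deriv_I u)"
    using u by (auto simp: W21_def)
  obtain N where N: "negligible N"
    and eqN: "\<And>t. t \<in> I01 - N \<Longrightarrow> deriv_I u differentiable (at t within I01) \<and> L_op a lam u t = \<sigma> t"
  proof -
    have "AE t in lebesgue. t \<in> I01 \<longrightarrow> deriv_I u differentiable (at t within I01) \<and> L_op a lam u t = \<sigma> t"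
      using sol unfolding solves_ae_def by (subst (asm) AE_restrict_space_iff) auto
    then show ?thesis
      using that unfolding eventually_ae_filter negligible_iff_null_sets by auto
  qed
  define c where "c = deriv_I u 0"
  have aui: "(\<lambda>s. a s * u s) integrable_on I01"
    using absolutely_integrable_mult_continuous[OF a contu] set_lebesgue_integral_eq_integral(1) by blast
  have rep: "deriv_I u t = c + integral {0..t} (\<lambda>s. \<sigma> s - lam * u s) - integral {0..t} (\<lambda>s. a s * u s)"
    if t: "t \<in> I01" for t
  proof -
    have sub: "{0..t} \<subseteq> I01" using t by auto
    have "((\<lambda>s. \<sigma> s - (a s + lam) * u s) has_integral deriv_I u t - deriv_I u 0) {0..t}"
    proof (rule AC_on_has_integral[OF AC sub _ N])
      fix s assume s: "s \<in> {0..t} - N"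
      then have sI: "s \<in> I01 - N" using sub by auto
      have "(deriv_I u has_real_derivative deriv_I (deriv_I u) s) (at s within I01)"
        using eqN[OF sI] vector_derivative_works[of "deriv_I u" "at s within I01"]
        unfolding deriv_I_def[of "deriv_I u"] has_real_derivative_iff_has_vector_derivative by blast
      then have "(deriv_I u has_real_derivative \<sigma> s - (a s + lam) * u s) (at s within I01)"
        by (rule DERIV_cong) (use eqN[OF sI] in \<open>simp add: L_op_def\<close>)
      then show "(deriv_I u has_real_derivative \<sigma> s - (a s + lam) * u s) (at s within {0..t})"
        using sub by (rule has_field_derivative_subset)
    qed (use t in auto)
    moreover have "(\<lambda>s. \<sigma> s - lam * u s) integrable_on {0..t}"
      using contu \<sigma> sub by (intro integrable_continuous_real continuous_intros) (auto elim: continuous_on_subset)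
    moreover have "(\<lambda>s. a s * u s) integrable_on {0..t}"
      using aui sub by (auto intro: integrable_on_subinterval)
    ultimately have "deriv_I u t - deriv_I u 0 =
        integral {0..t} (\<lambda>s. (\<sigma> s - lam * u s) - a s * u s)"
      by (simp add: algebra_simps integral_unique)
    also have "\<dots> = integral {0..t} (\<lambda>s. \<sigma> s - lam * u s) - integral {0..t} (\<lambda>s. a s * u s)"
      by (rule Henstock_Kurzweil_Integration.integral_diff) fact+
    finally show ?thesis by (simp add: c_def)
  qed
  have cont0: "continuous_on I01 (\<lambda>s. \<sigma> s - lam * u s)"
    using contu \<sigma> by (intro continuous_intros)
  have contd: "continuous_on I01 (deriv_I u)"
  proof -
    have "continuous_on I01 (\<lambda>t. c + integral {0..t} (\<lambda>s. \<sigma> s - lam * u s) - integral {0..t} (\<lambda>s. a s * u s))"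
      using indefinite_integral_continuous_1[OF integrable_continuous_real[OF cont0]]
        indefinite_integral_continuous_1[OF aui] by (intro continuous_on_add continuous_on_diff continuous_on_const)
    then show ?thesis by (rule continuous_on_cong[THEN iffD1, OF refl, rotated]) (simp add: rep)
  qed
  show ?thesis
    unfolding lin_sys_def
  proof (intro ballI conjI)
    fix t :: real assume t: "t \<in> I01"
    show "(u has_real_derivative deriv_I u t + B t * u t - B t * u t) (at t within I01)"
      using du[OF t] by simp
    have "((\<lambda>t. c + integral {0..t} (\<lambda>s. \<sigma> s - lam * u s)
        + (integral {0..t} a * u t - integral {0..t} (\<lambda>s. a s * u s)))
      has_real_derivative 0 + (\<sigma> t - lam * u t) + integral {0..t} a * deriv_I u t) (at t within I01)"
      by (intro DERIV_add DERIV_const integral_has_real_derivative[OF cont0 t]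
            has_derivative_indefinite_product[OF a du contd t])
    then have "((\<lambda>t. deriv_I u t + B t * u t)
      has_real_derivative 0 + (\<sigma> t - lam * u t) + integral {0..t} a * deriv_I u t) (at t within I01)"
      by (rule has_field_derivative_transform_within[where d=1]) (use t rep in \<open>auto simp: B_def\<close>)
    then show "((\<lambda>t. deriv_I u t + B t * u t) has_real_derivative
        \<sigma> t + B t * (deriv_I u t + B t * u t) - ((B t)\<^sup>2 + lam) * u t) (at t within I01)"
      by (rule DERIV_cong) (simp add: B_def algebra_simps power2_eq_square)
  qed
qed

section \<open>Existence and continuous dependence on the parameter\<close>

text \<open>The substitution \<open>s \<mapsto> t s\<close> moves the variable endpoint into the integrand, where continuity
  in the parameters is known.\<close>

lemma continuous_on_indefinite_integral_param:
  fixes g :: "real \<Rightarrow> real \<Rightarrow> 'b::banach"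
  assumes "continuous_on (S \<times> {0..1}) (\<lambda>(l, s). g l s)"
  shows "continuous_on (S \<times> {0..1}) (\<lambda>(l, t). integral {0..t} (g l))"
proof -
  have scale: "integral {0..t} (g l) = t *\<^sub>R integral {0..1} (\<lambda>s. g l (t * s))"
    if "l \<in> S" "t \<in> {0..1}" for l t
  proof (cases "t = 0")
    case False
    then have t: "0 < t" "t \<le> 1" using that by auto
    have "continuous_on {0..t} (g l)"
      by (rule continuous_on_compose2[OF assms, of _ "\<lambda>s. (l, s)", simplified])
         (use that t in \<open>auto intro!: continuous_intros\<close>)
    then have "(g l has_integral integral {0..t} (g l)) {0..t}"
      by (intro integrable_integral integrable_continuous_real)
    from has_integral_stretch_real[OF this False]
    have "((\<lambda>s. g l (t * s)) has_integral (1 / \<bar>t\<bar>) *\<^sub>R integral {0..t} (g l)) ((\<lambda>x. x / t) ` {0..t})" .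
    moreover have "(\<lambda>x. x / t) ` {0..t} = {0..1}"
      using t image_divide_atLeastAtMost[of t 0 t] by simp
    ultimately show ?thesis using t by (simp add: integral_unique)
  qed simp
  have "continuous_on (S \<times> {0..1}) (\<lambda>x. snd x *\<^sub>R integral (cbox 0 1) (\<lambda>s. g (fst x) (snd x * s)))"
  proof (intro continuous_intros integral_continuous_on_param)
    show "continuous_on ((S \<times> {0..1}) \<times> cbox 0 1) (\<lambda>(x, s). g (fst x) (snd x * s))"
    proof -
      have "continuous_on ((S \<times> {0..1}) \<times> cbox 0 1)
          (\<lambda>z. (\<lambda>(l, s). g l s) (fst (fst z), snd (fst z) * snd z))"
        by (rule continuous_on_compose2[OF assms]) (auto simp: mult_le_one intro!: continuous_intros)
      then show ?thesis by (simp add: split_beta)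
    qed
  qed
  then show ?thesis
    by (rule continuous_on_cong[THEN iffD1, rotated 2]) (auto simp: scale)
qed

text \<open>Parametrized Picard--Lindeloef theorem on the whole interval. The fixed point is taken among
  bounded continuous functions of \<open>(l, t)\<close> together, so joint continuity in parameter and time
  comes with existence. Writing \<open>X = exp(\<mu> t) Z\<close> with \<open>\<mu> > 2 K\<close> makes the integral operator on \<open>Z\<close>
  a contraction without subdividing the interval.\<close>

theorem picard_lindeloef_param:
  fixes f :: "real \<Rightarrow> real \<Rightarrow> 'b::banach \<Rightarrow> 'b"
  assumes l01: "l0 \<le> l1"
    and cont: "continuous_on ({l0..l1} \<times> {0..1} \<times> UNIV) (\<lambda>(l, t, x). f l t x)"
    and lip: "\<And>l t x y. l \<in> {l0..l1} \<Longrightarrow> t \<in> {0..1} \<Longrightarrow> norm (f l t x - f l t y) \<le> K * norm (x - y)"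
    and K: "0 \<le> K"
  obtains X where "continuous_on ({l0..l1} \<times> {0..1}) (\<lambda>(l, t). X l t)"
    and "\<And>l. l \<in> {l0..l1} \<Longrightarrow> X l 0 = x0"
    and "\<And>l t. l \<in> {l0..l1} \<Longrightarrow> t \<in> {0..1} \<Longrightarrow>
          (X l has_vector_derivative f l t (X l t)) (at t within {0..1})"
proof -
  define D where "D = {l0..l1} \<times> {0..1::real}"
  define \<mu> where "\<mu> = 2 * K + 1"
  have \<mu>: "0 < \<mu>" "K \<le> \<mu> / 2" using K by (auto simp: \<mu>_def)
  have D: "cbox (l0, 0) (l1, 1) = D" by (simp add: D_def cbox_Pair_eq)
  define F where "F = (\<lambda>(Z :: (real \<times> real) \<Rightarrow>\<^sub>C 'b) l s. f l s (exp (\<mu> * s) *\<^sub>R apply_bcontfun Z (l, s)))"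
  define P where "P = (\<lambda>Z (l, t). exp (- \<mu> * t) *\<^sub>R (x0 + integral {0..t} (F Z l)))"
  have contF: "continuous_on D (\<lambda>(l, s). F Z l s)" for Z
  proof -
    have "continuous_on D (\<lambda>z. (\<lambda>(l, t, x). f l t x)
        (fst z, snd z, exp (\<mu> * snd z) *\<^sub>R apply_bcontfun Z z))"
      by (rule continuous_on_compose2[OF cont]) (auto simp: D_def intro!: continuous_intros)
    then show ?thesis by (simp add: F_def split_beta)
  qed
  have contFl: "continuous_on {0..t} (F Z l)" if "l \<in> {l0..l1}" "t \<in> {0..1}" for Z l t
  proof -
    have "continuous_on {0..t} (\<lambda>s. (\<lambda>(l, s). F Z l s) (l, s))"
      by (rule continuous_on_compose2[OF contF[of Z]]) (use that in \<open>auto simp: D_def intro!: continuous_intros\<close>)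
    then show ?thesis by simp
  qed
  have contP: "continuous_on (cbox (l0, 0) (l1, 1)) (P Z)" for Z
    unfolding P_def D using continuous_on_indefinite_integral_param[OF contF[of Z, unfolded D_def]]
    by (auto simp: D_def split_beta intro!: continuous_intros)
  have "\<exists>T. (\<forall>x \<in> D. apply_bcontfun T x = P Z x) \<and> (\<forall>x. T x = P Z (clamp (l0, 0) (l1, 1) x))" for Z
    using continuous_on_cbox_bcontfunE[OF contP[of Z]] D by metis
  then obtain T where T: "\<And>Z x. x \<in> D \<Longrightarrow> apply_bcontfun (T Z) x = P Z x"
    and Tc: "\<And>Z x. apply_bcontfun (T Z) x = P Z (clamp (l0, 0) (l1, 1) x)"
    by metis
  have clampD: "clamp (l0, 0) (l1, 1) x \<in> D" for x :: "real \<times> real"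
    unfolding D[symmetric] by (rule clamp_in_interval) (use l01 in \<open>auto simp: Basis_prod_def\<close>)
  have est: "dist (P Z (l, t)) (P Y (l, t)) \<le> (1 / 2) * dist Z Y" if lt: "l \<in> {l0..l1}" "t \<in> {0..1}" for Z Y l t
  proof -
    have Fest: "norm (F Z l s - F Y l s) \<le> (K * dist Z Y) * exp (\<mu> * s)" if "s \<in> {0..t}" for s
    proof -
      have "norm (F Z l s - F Y l s) \<le> K * norm (exp (\<mu> * s) *\<^sub>R (apply_bcontfun Z (l, s) - apply_bcontfun Y (l, s)))"
        unfolding F_def scaleR_diff_right using lip lt that by auto
      also have "\<dots> \<le> K * (exp (\<mu> * s) * dist Z Y)"
        using K dist_bounded[of Z "(l, s)" Y] by (intro mult_left_mono) (auto simp: dist_norm)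
      finally show ?thesis by (simp add: mult_ac)
    qed
    have intE: "((\<lambda>s. (K * dist Z Y) * exp (\<mu> * s)) has_integral
        (K * dist Z Y) * (exp (\<mu> * t) / \<mu>) - (K * dist Z Y) * (exp (\<mu> * 0) / \<mu>)) {0..t}"
      using lt \<mu> by (intro fundamental_theorem_of_calculus)
        (auto intro!: derivative_eq_intros simp: has_real_derivative_iff_has_vector_derivative[symmetric])
    have "norm (integral {0..t} (F Z l) - integral {0..t} (F Y l)) = norm (integral {0..t} (\<lambda>s. F Z l s - F Y l s))"
      using contFl[OF lt] by (subst Henstock_Kurzweil_Integration.integral_diff)
        (auto intro: integrable_continuous_real)
    also have "\<dots> \<le> integral {0..t} (\<lambda>s. (K * dist Z Y) * exp (\<mu> * s))"
      using Fest contFl[OF lt] intE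
      by (intro integral_norm_bound_integral integrable_diff integrable_continuous_real[of 0 t "F Z l"]
           integrable_continuous_real[of 0 t "F Y l"]) (auto simp: has_integral_integrable)
    also have "\<dots> = (K * dist Z Y) * ((exp (\<mu> * t) - 1) / \<mu>)"
      using integral_unique[OF intE] by (simp add: algebra_simps diff_divide_distrib)
    also have "\<dots> \<le> (\<mu> / 2 * dist Z Y) * (exp (\<mu> * t) / \<mu>)"
      using \<mu> K lt by (intro mult_mono mult_right_mono divide_right_mono) auto
    also have "\<dots> = exp (\<mu> * t) * (1 / 2 * dist Z Y)" using \<mu> by simp
    finally have *: "norm (integral {0..t} (F Z l) - integral {0..t} (F Y l)) \<le> exp (\<mu> * t) * (1 / 2 * dist Z Y)" .
    have "dist (P Z (l, t)) (P Y (l, t)) = exp (- \<mu> * t) * norm (integral {0..t} (F Z l) - integral {0..t} (F Y l))"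
      unfolding P_def dist_norm by (simp add: scaleR_diff_right[symmetric])
    also have "\<dots> \<le> exp (- \<mu> * t) * (exp (\<mu> * t) * (1 / 2 * dist Z Y))"
      using * by (intro mult_left_mono) auto
    also have "\<dots> = 1 / 2 * dist Z Y" by (simp add: mult.assoc[symmetric] exp_add[symmetric])
    finally show ?thesis .
  qed
  have "\<exists>!Z. T Z = Z"
  proof (rule banach_fix_type[where c="1/2"])
    show "\<forall>Z Y. dist (T Z) (T Y) \<le> (1 / 2) * dist Z Y"
    proof (intro allI dist_bound)
      fix Z Y :: "(real \<times> real) \<Rightarrow>\<^sub>C 'b" and x
      show "dist (apply_bcontfun (T Z) x) (apply_bcontfun (T Y) x) \<le> (1 / 2) * dist Z Y"
        unfolding Tc using clampD[of x] est
        by (cases "clamp (l0, 0) (l1, 1) x") (auto simp: D_def)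
    qed
  qed auto
  then obtain Z where Z: "T Z = Z" by blast
  define X where "X = (\<lambda>l t. exp (\<mu> * t) *\<^sub>R apply_bcontfun Z (l, t))"
  have X: "X l t = x0 + integral {0..t} (\<lambda>s. f l s (X l s))" if "l \<in> {l0..l1}" "t \<in> {0..1}" for l t
  proof -
    have "apply_bcontfun Z (l, t) = P Z (l, t)" using T[of "(l, t)" Z] Z that by (simp add: D_def)
    then show ?thesis by (simp add: X_def P_def F_def exp_add[symmetric])
  qed
  show ?thesis
  proof (rule that)
    show "continuous_on ({l0..l1} \<times> {0..1}) (\<lambda>(l, t). X l t)"
      unfolding X_def split_beta by (intro continuous_intros) auto
    show "X l 0 = x0" if "l \<in> {l0..l1}" for l using X[OF that, of 0] by simp
    fix l t :: real assume lt: "l \<in> {l0..l1}" "t \<in> {0..1}"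
    have "continuous_on {0..1} (\<lambda>s. f l s (X l s))"
      using contFl[of l 1 Z] lt by (simp add: F_def X_def)
    then have "((\<lambda>t. x0 + integral {0..t} (\<lambda>s. f l s (X l s))) has_vector_derivative 0 + f l t (X l t)) (at t within {0..1})"
      using lt by (intro has_vector_derivative_add has_vector_derivative_const integral_has_vector_derivative)
    then have "((\<lambda>t. x0 + integral {0..t} (\<lambda>s. f l s (X l s))) has_vector_derivative f l t (X l t)) (at t within {0..1})"
      by simp
    then show "(X l has_vector_derivative f l t (X l t)) (at t within {0..1})"
      by (rule has_vector_derivative_transform[rotated 2]) (use lt X in auto)
  qed
qed

text \<open>On a bounded range of \<open>l\<close> the right-hand side of the system is Lipschitz in \<open>(u, y)\<close>, uniformly
  in \<open>(l, t)\<close>.\<close>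

lemma lin_sys_family_exists:
  assumes B: "continuous_on I01 B" and l01: "l0 \<le> l1"
  obtains u y where "continuous_on ({l0..l1} \<times> I01) (\<lambda>(l, t). u l t)"
    and "continuous_on ({l0..l1} \<times> I01) (\<lambda>(l, t). y l t)"
    and "\<And>l. l \<in> {l0..l1} \<Longrightarrow> lin_sys B l (\<lambda>_. 0) (u l) (y l) \<and> u l 0 = c \<and> y l 0 = d"
proof -
  have "bounded (B ` I01)" using B by (intro compact_imp_bounded compact_continuous_image) auto
  then obtain M where M: "\<And>t. t \<in> I01 \<Longrightarrow> \<bar>B t\<bar> \<le> M"
    unfolding bounded_iff by (metis image_eqI real_norm_def)
  have M0: "0 \<le> M" using M[of 0] by auto
  define \<Lambda> where "\<Lambda> = \<bar>l0\<bar> + \<bar>l1\<bar>"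
  define f where "f = (\<lambda>l t (x :: real \<times> real). (snd x - B t * fst x, B t * snd x - ((B t)\<^sup>2 + l) * fst x))"
  define K where "K = (1 + M) + (M + (M\<^sup>2 + \<Lambda>))"
  have contB: "continuous_on ({l0..l1} \<times> I01 \<times> (UNIV :: (real \<times> real) set)) (\<lambda>z. B (fst (snd z)))"
    by (rule continuous_on_compose2[OF B]) (auto intro!: continuous_intros)
  obtain X where X: "continuous_on ({l0..l1} \<times> I01) (\<lambda>(l, t). X l t)"
    "\<And>l. l \<in> {l0..l1} \<Longrightarrow> X l 0 = (c, d)"
    "\<And>l t. l \<in> {l0..l1} \<Longrightarrow> t \<in> I01 \<Longrightarrow> (X l has_vector_derivative f l t (X l t)) (at t within I01)"
  proof (rule picard_lindeloef_param[of l0 l1 f K "(c, d)"])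
    show "continuous_on ({l0..l1} \<times> I01 \<times> UNIV) (\<lambda>(l, t, x). f l t x)"
      unfolding f_def split_beta by (intro continuous_intros contB)
    fix l t :: real and x y :: "real \<times> real" assume lt: "l \<in> {l0..l1}" "t \<in> I01"
    define p where "p = x - y"
    have f: "f l t x - f l t y = (snd p - B t * fst p, B t * snd p - ((B t)\<^sup>2 + l) * fst p)"
      by (simp add: f_def p_def algebra_simps)
    have n: "\<bar>fst p\<bar> \<le> norm p" "\<bar>snd p\<bar> \<le> norm p"
      using norm_fst_le[of "fst p" "snd p"] norm_snd_le[of "snd p" "fst p"] by auto
    have b: "\<bar>B t\<bar> \<le> M" using M lt by auto
    have b2: "\<bar>(B t)\<^sup>2 + l\<bar> \<le> M\<^sup>2 + \<Lambda>"
    proof -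
      have "(B t)\<^sup>2 \<le> M\<^sup>2" "0 \<le> (B t)\<^sup>2" "\<bar>l\<bar> \<le> \<Lambda>"
        using power_mono[OF b abs_ge_zero, of 2] lt by (auto simp: \<Lambda>_def)
      then show ?thesis by linarith
    qed
    have "norm (f l t x - f l t y) \<le> \<bar>snd p - B t * fst p\<bar> + \<bar>B t * snd p - ((B t)\<^sup>2 + l) * fst p\<bar>"
      unfolding f using norm_Pair_le by (metis real_norm_def)
    also have "\<dots> \<le> (\<bar>snd p\<bar> + \<bar>B t\<bar> * \<bar>fst p\<bar>) + (\<bar>B t\<bar> * \<bar>snd p\<bar> + \<bar>(B t)\<^sup>2 + l\<bar> * \<bar>fst p\<bar>)"
      unfolding abs_mult[symmetric] by linarith
    also have "\<dots> \<le> (norm p + M * norm p) + (M * norm p + (M\<^sup>2 + \<Lambda>) * norm p)"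
      using n b b2 M0 by (intro add_mono mult_mono) (auto simp: \<Lambda>_def)
    also have "\<dots> = K * norm (x - y)" by (simp add: K_def p_def algebra_simps)
    finally show "norm (f l t x - f l t y) \<le> K * norm (x - y)" .
  next
    show "0 \<le> K" using M0 by (simp add: K_def \<Lambda>_def)
  qed (use l01 in auto)
  show ?thesis
  proof (rule that[of "\<lambda>l t. fst (X l t)" "\<lambda>l t. snd (X l t)"])
    show "continuous_on ({l0..l1} \<times> I01) (\<lambda>(l, t). fst (X l t))"
      "continuous_on ({l0..l1} \<times> I01) (\<lambda>(l, t). snd (X l t))"
      using continuous_on_fst[OF X(1)] continuous_on_snd[OF X(1)] by (simp_all add: split_beta)
    fix l assume l: "l \<in> {l0..l1}"
    have "lin_sys B l (\<lambda>_. 0) (\<lambda>t. fst (X l t)) (\<lambda>t. snd (X l t))"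
      unfolding lin_sys_def has_real_derivative_iff_has_vector_derivative
    proof (intro ballI conjI)
      fix t :: real assume t: "t \<in> I01"
      have "((\<lambda>t. fst (X l t)) has_vector_derivative fst (f l t (X l t))) (at t within I01)"
        using X(3)[OF l t] by (rule bounded_linear.has_vector_derivative[OF bounded_linear_fst])
      then show "((\<lambda>t. fst (X l t)) has_vector_derivative snd (X l t) - B t * fst (X l t)) (at t within I01)"
        by (simp add: f_def)
      have "((\<lambda>t. snd (X l t)) has_vector_derivative snd (f l t (X l t))) (at t within I01)"
        using X(3)[OF l t] by (rule bounded_linear.has_vector_derivative[OF bounded_linear_snd])
      then show "((\<lambda>t. snd (X l t)) has_vector_derivative
          0 + B t * snd (X l t) - ((B t)\<^sup>2 + l) * fst (X l t)) (at t within I01)"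
        by (simp add: f_def)
    qed
    then show "lin_sys B l (\<lambda>_. 0) (\<lambda>t. fst (X l t)) (\<lambda>t. snd (X l t)) \<and> fst (X l 0) = c \<and> snd (X l 0) = d"
      using X(2)[OF l] by simp
  qed
qed

section \<open>Wronskians and Green's functions\<close>

lemma lin_sysD:
  assumes "lin_sys B l \<sigma> u y" "t \<in> I01"
  shows "(u has_real_derivative y t - B t * u t) (at t within I01)"
    and "(y has_real_derivative \<sigma> t + B t * y t - ((B t)\<^sup>2 + l) * u t) (at t within I01)"
  using assms by (auto simp: lin_sys_def)

lemma lin_sys_continuous:
  assumes "lin_sys B l \<sigma> u y"
  shows "continuous_on I01 u" "continuous_on I01 y"
  by (rule DERIV_continuous_on, erule lin_sysD[OF assms])+

lemma lin_sys_lincomb: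
  assumes "lin_sys B l \<sigma> u y" "lin_sys B l \<tau> v z"
  shows "lin_sys B l (\<lambda>t. c * \<sigma> t + d * \<tau> t) (\<lambda>t. c * u t + d * v t) (\<lambda>t. c * y t + d * z t)"
  unfolding lin_sys_def
proof (intro ballI conjI)
  fix t :: real assume t: "t \<in> I01"
  note D = lin_sysD[OF assms(1) t] lin_sysD[OF assms(2) t]
  show "((\<lambda>t. c * u t + d * v t) has_real_derivative c * y t + d * z t - B t * (c * u t + d * v t)) (at t within I01)"
    using D(1,3) by (auto intro!: derivative_eq_intros simp: algebra_simps)
  show "((\<lambda>t. c * y t + d * z t) has_real_derivative
      c * \<sigma> t + d * \<tau> t + B t * (c * y t + d * z t) - ((B t)\<^sup>2 + l) * (c * u t + d * v t)) (at t within I01)"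
    using D(2,4) by (auto intro!: derivative_eq_intros simp: algebra_simps)
qed

lemma lin_sys_change_parameter:
  assumes "lin_sys B l \<sigma> u y"
  shows "lin_sys B l' (\<lambda>t. \<sigma> t + (l' - l) * u t) u y"
  unfolding lin_sys_def
proof (intro ballI conjI)
  fix t :: real assume t: "t \<in> I01"
  show "(u has_real_derivative y t - B t * u t) (at t within I01)" using lin_sysD[OF assms t] by simp
  show "(y has_real_derivative \<sigma> t + (l' - l) * u t + B t * y t - ((B t)\<^sup>2 + l') * u t) (at t within I01)"
    by (rule DERIV_cong[OF lin_sysD(2)[OF assms t]]) (simp add: algebra_simps)
qed

text \<open>\<open>v y - z u\<close> equals the Wronskian \<open>v u' - v' u\<close>, because the terms with \<open>B\<close> cancel.\<close>

lemma lagrange_identity: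
  assumes "lin_sys B l \<sigma> u y" "lin_sys B l \<tau> v z" "t \<in> I01"
  shows "((\<lambda>t. v t * y t - z t * u t) has_real_derivative v t * \<sigma> t - u t * \<tau> t) (at t within I01)"
  using lin_sysD[OF assms(1,3)] lin_sysD[OF assms(2,3)]
  by (auto intro!: derivative_eq_intros simp: algebra_simps power2_eq_square)

lemma greens_formula:
  assumes "lin_sys B l \<sigma> u y" "lin_sys B l \<tau> v z" "0 \<le> p" "p \<le> q" "q \<le> 1"
  shows "((\<lambda>s. v s * \<sigma> s - u s * \<tau> s) has_integral (v q * y q - z q * u q) - (v p * y p - z p * u p)) {p..q}"
proof (rule fundamental_theorem_of_calculus[OF assms(4)])
  fix t assume "t \<in> {p..q}"
  then have "t \<in> I01" using assms by auto
  from lagrange_identity[OF assms(1,2) this]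
  show "((\<lambda>t. v t * y t - z t * u t) has_vector_derivative v t * \<sigma> t - u t * \<tau> t) (at t within {p..q})"
    unfolding has_real_derivative_iff_has_vector_derivative[symmetric]
    by (rule has_field_derivative_subset) (use assms in auto)
qed

lemma wronskian_constant:
  assumes "lin_sys B l (\<lambda>_. 0) u y" "lin_sys B l (\<lambda>_. 0) v z" "t \<in> I01"
  shows "v t * y t - z t * u t = v 0 * y 0 - z 0 * u 0"
proof -
  have "((\<lambda>s. v s * 0 - u s * 0) has_integral (v t * y t - z t * u t) - (v 0 * y 0 - z 0 * u 0)) {0..t}"
    using assms by (intro greens_formula[of B l]) auto
  then show ?thesis using has_integral_0_eq by force
qed

text \<open>Variation of constants. Green's formula for \<open>u\<close> and \<open>\<alpha>\<close> on \<open>[0,t]\<close>, and for \<open>u\<close> and \<open>v\<close> on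
  \<open>[t,1]\<close>, has boundary terms at \<open>t\<close> only, since \<open>\<alpha>\<close> shares the boundary condition of \<open>u\<close> at \<open>0\<close>
  and \<open>v\<close> the one at \<open>1\<close>. Eliminating the quasi-derivative of \<open>u\<close> at \<open>t\<close> leaves \<open>u(t)\<close> times
  the Wronskian of \<open>\<alpha>\<close> and \<open>v\<close>.\<close>

lemma solution_representation:
  assumes u: "lin_sys B l \<sigma> u y" and \<alpha>: "lin_sys B l (\<lambda>_. 0) \<alpha> \<beta>" and v: "lin_sys B l (\<lambda>_. 0) v z"
    and bc0: "\<alpha> 0 * y 0 = \<beta> 0 * u 0" and bc1: "v 1 * y 1 = z 1 * u 1" and t: "t \<in> I01"
  shows "(\<alpha> t * z t - \<beta> t * v t) * u t
    = v t * integral {0..t} (\<lambda>s. \<alpha> s * \<sigma> s) + \<alpha> t * integral {t..1} (\<lambda>s. v s * \<sigma> s)"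
proof -
  have "integral {0..t} (\<lambda>s. \<alpha> s * \<sigma> s) = \<alpha> t * y t - \<beta> t * u t"
    using integral_unique[OF greens_formula[OF u \<alpha>, of 0 t]] t bc0 by simp
  moreover have "integral {t..1} (\<lambda>s. v s * \<sigma> s) = - (v t * y t - z t * u t)"
    using integral_unique[OF greens_formula[OF u v, of t 1]] t bc1 by simp
  ultimately show ?thesis by (simp only:) (simp add: algebra_simps)
qed

text \<open>Any Green's function is the classical kernel: both represent the same solution for every
  continuous right-hand side. For fixed \<open>t\<close> the right-hand side is chosen to be the difference
  of the two kernels itself, so that the integral of its square vanishes.\<close>

lemma greens_function_eq:
  assumes a: "a absolutely_integrable_on I01" and G: "is_greens_function a X l G" and X: "X \<subseteq> W21"
    and B: "B = (\<lambda>t. integral {0..t} a)"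
    and \<alpha>: "lin_sys B l (\<lambda>_. 0) \<alpha> \<beta>" and v: "lin_sys B l (\<lambda>_. 0) v z"
    and \<omega>: "\<And>t. t \<in> I01 \<Longrightarrow> \<alpha> t * z t - \<beta> t * v t = \<omega>" "\<omega> \<noteq> 0"
    and bc0: "\<And>u. u \<in> X \<Longrightarrow> \<alpha> 0 * deriv_I u 0 = \<beta> 0 * u 0"
    and bc1: "\<And>u. u \<in> X \<Longrightarrow> v 1 * (deriv_I u 1 + B 1 * u 1) = z 1 * u 1"
    and t: "t \<in> I01" and s: "s \<in> I01"
  shows "G t s = (if s \<le> t then v t * \<alpha> s else \<alpha> t * v s) / \<omega>"
proof -
  define k where "k = (\<lambda>s. (if s \<le> t then v t * \<alpha> s else \<alpha> t * v s) / \<omega>)"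
  define \<sigma> where "\<sigma> = (\<lambda>s. G t s - k s)"
  define u where "u = (\<lambda>t. LINT s:I01|lebesgue. G t s * \<sigma> s)"
  note c\<alpha> = lin_sys_continuous(1)[OF \<alpha>] and cv = lin_sys_continuous(1)[OF v]
  have "continuous_on ({0..t} \<union> {t..1}) (\<lambda>s. if s \<le> t then v t * \<alpha> s else \<alpha> t * v s)"
    using t c\<alpha> cv by (intro continuous_on_If continuous_intros) (auto elim: continuous_on_subset)
  moreover have tun: "{0..t} \<union> {t..1} = I01" using t by auto
  ultimately have ck: "continuous_on I01 k"
    unfolding k_def using \<omega>(2) by (intro continuous_intros) auto
  have cG2: "continuous_on (I01 \<times> I01) (\<lambda>(t, s). G t s)" using G by (simp add: is_greens_function_def)
  have cG: "continuous_on I01 (G t)"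
  proof -
    have "continuous_on I01 (\<lambda>s. (\<lambda>(t, s). G t s) (t, s))"
      by (rule continuous_on_compose2[OF cG2]) (use t in \<open>auto intro!: continuous_intros\<close>)
    then show ?thesis by simp
  qed
  have c\<sigma>: "continuous_on I01 \<sigma>" unfolding \<sigma>_def using cG ck by (intro continuous_intros)
  have "\<sigma> absolutely_integrable_on I01" using c\<sigma> by (rule absolutely_integrable_continuous_real)
  then have uX: "u \<in> X" and usol: "solves_ae a l \<sigma> u"
    using G unfolding is_greens_function_def u_def by auto
  have usys: "lin_sys B l \<sigma> u (\<lambda>t. deriv_I u t + B t * u t)"
    unfolding B using lin_sys_of_solves_ae[OF a _ usol c\<sigma>] uX X by auto
  have "\<omega> * u t = v t * integral {0..t} (\<lambda>s. \<alpha> s * \<sigma> s) + \<alpha> t * integral {t..1} (\<lambda>s. v s * \<sigma> s)"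
    using solution_representation[OF usys \<alpha> v _ _ t] bc0[OF uX] bc1[OF uX] \<omega>(1)[OF t] by (simp add: B)
  also have "\<dots> = \<omega> * integral I01 (\<lambda>s. k s * \<sigma> s)"
  proof -
    have int: "(\<lambda>s. k s * \<sigma> s) integrable_on I01"
      using ck c\<sigma> by (intro integrable_continuous_real continuous_intros)
    have "integral {0..t} (\<lambda>s. k s * \<sigma> s) = integral {0..t} (\<lambda>s. v t / \<omega> * (\<alpha> s * \<sigma> s))"
      by (rule integral_cong) (simp add: k_def)
    moreover have "integral {t..1} (\<lambda>s. k s * \<sigma> s) = integral {t..1} (\<lambda>s. \<alpha> t / \<omega> * (v s * \<sigma> s))"
      by (rule integral_cong) (auto simp: k_def)
    ultimately have "integral I01 (\<lambda>s. k s * \<sigma> s)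
        = v t / \<omega> * integral {0..t} (\<lambda>s. \<alpha> s * \<sigma> s) + \<alpha> t / \<omega> * integral {t..1} (\<lambda>s. v s * \<sigma> s)"
      using Henstock_Kurzweil_Integration.integral_combine[of 0 t 1, OF _ _ int] t by simp
    then show ?thesis using \<omega>(2) by (simp add: field_simps)
  qed
  finally have ut: "u t = integral I01 (\<lambda>s. k s * \<sigma> s)" using \<omega>(2) by simp
  have "u t = integral I01 (\<lambda>s. G t s * \<sigma> s)"
    unfolding u_def using cG c\<sigma>
    by (intro set_lebesgue_integral_eq_integral absolutely_integrable_continuous_real continuous_intros)
  then have "integral I01 (\<lambda>s. G t s * \<sigma> s - k s * \<sigma> s) = 0"
    using ut cG ck c\<sigma>
    by (subst Henstock_Kurzweil_Integration.integral_diff) (auto intro!: integrable_continuous_real continuous_intros)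
  then have "integral I01 (\<lambda>s. (\<sigma> s)\<^sup>2) = 0"
    by (simp add: \<sigma>_def power2_eq_square algebra_simps)
  then have "(\<sigma> s)\<^sup>2 = 0"
    using integral_eq_0_iff[OF continuous_on_power[OF c\<sigma>, of 2]] s by simp
  then show ?thesis by (simp add: \<sigma>_def k_def)
qed

section \<open>Positivity of solutions\<close>

lemma mono_of_deriv_nonneg:
  fixes f :: "real \<Rightarrow> real"
  assumes "\<And>x. x \<in> {p..q} \<Longrightarrow> (f has_real_derivative f' x) (at x within {p..q})"
    and "\<And>x. x \<in> {p..q} \<Longrightarrow> 0 \<le> f' x" and "p \<le> x" "x \<le> y" "y \<le> q"
  shows "f x \<le> f y"
proof (cases "x = y")
  case False
  then have "\<exists>z\<in>{x<..<y}. f y - f x = (\<lambda>h. f' z * h) (y - x)"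
    using assms(3-5) by (intro mvt_simple has_field_derivative_imp_has_derivative
        has_field_derivative_subset[OF assms(1)]) auto
  then show ?thesis using assms False by (smt (verit) atLeastAtMost_iff greaterThanLessThan_iff mult_nonneg_nonneg)
qed simp

lemma strict_mono_of_deriv_pos:
  fixes f :: "real \<Rightarrow> real"
  assumes "\<And>x. x \<in> {p..q} \<Longrightarrow> (f has_real_derivative f' x) (at x within {p..q})"
    and "\<And>x. x \<in> {p..q} \<Longrightarrow> 0 < f' x" and "p \<le> x" "x < y" "y \<le> q"
  shows "f x < f y"
proof -
  have "\<exists>z\<in>{x<..<y}. f y - f x = (\<lambda>h. f' z * h) (y - x)"
    using assms(3-5) by (intro mvt_simple has_field_derivative_imp_has_derivative
        has_field_derivative_subset[OF assms(1)]) auto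
  then show ?thesis using assms by (smt (verit) atLeastAtMost_iff greaterThanLessThan_iff mult_pos_pos)
qed

lemma continuous_nonzero_pos:
  fixes f :: "real \<Rightarrow> real"
  assumes "continuous_on {p..q} f" "0 < f p" "\<And>x. x \<in> {p..q} \<Longrightarrow> f x \<noteq> 0" "x \<in> {p..q}"
  shows "0 < f x"
proof (rule ccontr)
  assume "\<not> 0 < f x"
  then have "\<exists>z\<ge>p. z \<le> x \<and> f z = 0"
    using assms by (intro IVT2') (auto elim: continuous_on_subset)
  then show False using assms(3,4) by fastforce
qed

text \<open>With \<open>w = y - c t u\<close> the system becomes \<open>u' = (c t - B) u + w\<close>, \<open>w' = (B - c t) w + g u\<close>, and \<open>l\<close>
  is so negative that \<open>g \<ge> 0\<close>. Then \<open>(u w)' = w\<^sup>2 + g u\<^sup>2 \<ge> 0\<close>, so \<open>u w \<ge> 0\<close>, and \<open>u\<^sup>2\<close> decays at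
  most exponentially; in particular \<open>u\<close> stays positive and \<open>w\<close> nonnegative. The choice
  \<open>c > \<bar>B 1\<bar>\<close> turns \<open>w(1) \<ge> 0\<close> into \<open>u'(1) > 0\<close>.\<close>

lemma positive_for_very_negative_parameter:
  assumes sys: "lin_sys B l (\<lambda>_. 0) u y" and init: "u 0 = 1" "y 0 = 0"
    and M: "\<And>t. t \<in> I01 \<Longrightarrow> \<bar>B t\<bar> \<le> M"
    and l: "l \<le> - (M + 1) - (2 * M + 1)\<^sup>2"
  shows "\<And>t. t \<in> I01 \<Longrightarrow> 0 < u t" and "0 < y 1 - B 1 * u 1"
proof -
  define c where "c = M + 1"
  have M0: "0 \<le> M" using M[of 0] by auto
  define w where "w = (\<lambda>t. y t - c * t * u t)"
  define g where "g = (\<lambda>t. - l - c - (B t - c * t)\<^sup>2)"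
  have Bct: "\<bar>B t - c * t\<bar> \<le> 2 * M + 1" if "t \<in> I01" for t
  proof -
    have "0 \<le> c * t" "c * t \<le> c * 1" using that M0 by (auto simp: c_def intro!: mult_left_mono)
    then show ?thesis using M[OF that] by (auto simp: c_def)
  qed
  have g0: "0 \<le> g t" if "t \<in> I01" for t
    using power_mono[OF Bct[OF that] abs_ge_zero, of 2] l by (simp add: g_def c_def)
  note cu = lin_sys_continuous(1)[OF sys]
  have du: "(u has_real_derivative w t + (c * t - B t) * u t) (at t within I01)" if "t \<in> I01" for t
    by (rule DERIV_cong[OF lin_sysD(1)[OF sys that]]) (simp add: w_def algebra_simps)
  have dw: "(w has_real_derivative (B t - c * t) * w t + g t * u t) (at t within I01)" if "t \<in> I01" for t
    unfolding w_def using lin_sysD[OF sys that]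
    by (auto intro!: derivative_eq_intros simp: g_def algebra_simps power2_eq_square)
  have uw: "0 \<le> u t * w t" if "t \<in> I01" for t
  proof -
    have "u 0 * w 0 \<le> u t * w t"
    proof (rule mono_of_deriv_nonneg[of 0 1 "\<lambda>t. u t * w t" "\<lambda>t. (w t)\<^sup>2 + g t * (u t)\<^sup>2"])
      fix x :: real assume x: "x \<in> I01"
      show "((\<lambda>t. u t * w t) has_real_derivative (w x)\<^sup>2 + g x * (u x)\<^sup>2) (at x within I01)"
        using du[OF x] dw[OF x] by (auto intro!: derivative_eq_intros simp: algebra_simps power2_eq_square)
      show "0 \<le> (w x)\<^sup>2 + g x * (u x)\<^sup>2" using g0[OF x] by auto
    qed (use that in auto)
    then show ?thesis by (simp add: w_def init)
  qed
  define K where "K = 2 * M + 1"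
  have u2: "1 \<le> (u t)\<^sup>2 * exp (2 * K * t)" if "t \<in> I01" for t
  proof -
    have "(u 0)\<^sup>2 * exp (2 * K * 0) \<le> (u t)\<^sup>2 * exp (2 * K * t)"
    proof (rule mono_of_deriv_nonneg[of 0 1 "\<lambda>t. (u t)\<^sup>2 * exp (2 * K * t)"
          "\<lambda>t. 2 * exp (2 * K * t) * (u t * w t + (K - (B t - c * t)) * (u t)\<^sup>2)"])
      fix x :: real assume x: "x \<in> I01"
      show "((\<lambda>t. (u t)\<^sup>2 * exp (2 * K * t)) has_real_derivative
          2 * exp (2 * K * x) * (u x * w x + (K - (B x - c * x)) * (u x)\<^sup>2)) (at x within I01)"
        using du[OF x] by (auto intro!: derivative_eq_intros simp: algebra_simps power2_eq_square)
      have "0 \<le> (K - (B x - c * x)) * (u x)\<^sup>2"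
        using Bct[OF x] by (intro mult_nonneg_nonneg) (auto simp: K_def)
      then show "0 \<le> 2 * exp (2 * K * x) * (u x * w x + (K - (B x - c * x)) * (u x)\<^sup>2)"
        using uw[OF x] by simp
    qed (use that in auto)
    then show ?thesis by (simp add: init)
  qed
  show upos: "0 < u t" if "t \<in> I01" for t
  proof (rule continuous_nonzero_pos[OF cu _ _ that])
    show "u x \<noteq> 0" if "x \<in> I01" for x using u2[OF that] by auto
  qed (simp add: init)
  have "0 \<le> w 1" using uw[of 1] upos[of 1] by (simp add: zero_le_mult_iff)
  moreover have "0 < (c - B 1) * u 1" using M[of 1] upos[of 1] by (auto simp: c_def)
  ultimately show "0 < y 1 - B 1 * u 1" by (simp add: w_def algebra_simps)
qed

text \<open>Continuation in the spectral parameter. The slope at \<open>1\<close> keeps its sign because it never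
  vanishes. If \<open>u\<close> stopped being positive, then at the first such parameter \<open>u\<close> would be
  nonnegative with a zero. A zero at which \<open>u\<close> does not change sign is a double zero, unless it
  lies at an endpoint; it is not \<open>0\<close> because of the initial value, nor \<open>1\<close> because of the
  positive slope there.\<close>

lemma positivity_continuation:
  assumes l01: "l0 \<le> l1"
    and cu: "continuous_on ({l0..l1} \<times> I01) (\<lambda>(l, t). u l t)"
    and cy: "continuous_on ({l0..l1} \<times> I01) (\<lambda>(l, t). y l t)"
    and sys: "\<And>l. l \<in> {l0..l1} \<Longrightarrow> lin_sys B l (\<lambda>_. 0) (u l) (y l)"
    and init: "\<And>l. l \<in> {l0..l1} \<Longrightarrow> u l 0 = 1"
    and simple: "\<And>l t. l \<in> {l0..l1} \<Longrightarrow> t \<in> I01 \<Longrightarrow> u l t = 0 \<Longrightarrow> y l t \<noteq> 0"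
    and start: "\<And>t. t \<in> I01 \<Longrightarrow> 0 < u l0 t" "0 < y l0 1 - B 1 * u l0 1"
    and no_eig: "\<And>l. l \<in> {l0..l1} \<Longrightarrow> y l 1 - B 1 * u l 1 \<noteq> 0"
  shows "\<And>t. t \<in> I01 \<Longrightarrow> 0 < u l1 t" and "0 < y l1 1 - B 1 * u l1 1"
proof -
  have cut: "continuous_on {l0..l1} (\<lambda>l. u l t)" and cyt: "continuous_on {l0..l1} (\<lambda>l. y l t)"
    if "t \<in> I01" for t
  proof -
    have "continuous_on {l0..l1} (\<lambda>l. (\<lambda>(l, t). u l t) (l, t))"
      by (rule continuous_on_compose2[OF cu]) (use that in \<open>auto intro!: continuous_intros\<close>)
    moreover have "continuous_on {l0..l1} (\<lambda>l. (\<lambda>(l, t). y l t) (l, t))"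
      by (rule continuous_on_compose2[OF cy]) (use that in \<open>auto intro!: continuous_intros\<close>)
    ultimately show "continuous_on {l0..l1} (\<lambda>l. u l t)" "continuous_on {l0..l1} (\<lambda>l. y l t)" by auto
  qed
  have slope: "0 < y l 1 - B 1 * u l 1" if "l \<in> {l0..l1}" for l
    by (rule continuous_nonzero_pos[of l0 l1 "\<lambda>l. y l 1 - B 1 * u l 1"])
       (use start no_eig that cut[of 1] cyt[of 1] in \<open>auto intro!: continuous_intros\<close>)
  define Z where "Z = {z \<in> {l0..l1} \<times> I01. (\<lambda>(l, t). u l t) z \<in> {..0}}"
  have "Z = {}"
  proof (rule ccontr)
    assume ne: "Z \<noteq> {}"
    have "compact Z"
    proof -
      have "closed (({l0..l1} \<times> I01) \<inter> (\<lambda>(l, t). u l t) -` {..0})"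
        by (rule continuous_closed_preimage[OF cu]) (auto intro: closed_Times)
      moreover have "({l0..l1} \<times> I01) \<inter> (\<lambda>(l, t). u l t) -` {..0} = Z" by (auto simp: Z_def)
      moreover have "compact ({l0..l1} \<times> I01)" by (intro compact_Times) auto
      ultimately show ?thesis by (metis (no_types, lifting) compact_Int_closed Int_assoc Int_absorb)
    qed
    then obtain z where z: "z \<in> Z" and zmin: "\<And>z'. z' \<in> Z \<Longrightarrow> fst z \<le> fst z'"
      using continuous_attains_inf[OF _ ne continuous_on_fst[OF continuous_on_id]] by blast
    obtain \<kappa> t0 where zk: "z = (\<kappa>, t0)" by (cases z)
    have \<kappa>: "\<kappa> \<in> {l0..l1}" and t0: "t0 \<in> I01" and le0: "u \<kappa> t0 \<le> 0"
      using z by (auto simp: zk Z_def)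
    have minl: "\<kappa> \<le> l" if "l \<in> {l0..l1}" "t \<in> I01" "u l t \<le> 0" for l t
      using zmin[of "(l, t)"] that by (simp add: Z_def zk)
    have ge0: "0 \<le> u \<kappa> t" if t: "t \<in> I01" for t
    proof (rule ccontr)
      assume neg: "\<not> 0 \<le> u \<kappa> t"
      have "\<exists>l\<ge>l0. l \<le> \<kappa> \<and> u l t = 0"
        using neg \<kappa> start(1)[OF t] cut[OF t] by (intro IVT2') (auto elim: continuous_on_subset)
      then obtain l where l: "l0 \<le> l" "l \<le> \<kappa>" "u l t = 0" by blast
      then have "l = \<kappa>" using minl[of l t] \<kappa> t by auto
      then show False using l neg by simp
    qed
    have eq0: "u \<kappa> t0 = 0" using le0 ge0[OF t0] by simp
    have t0pos: "0 < t0" using eq0 init[OF \<kappa>] t0 by (cases "t0 = 0") auto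
    \<comment> \<open>At a zero of \<open>u\<close> the quasi-derivative is the derivative.\<close>
    have der: "(u \<kappa> has_real_derivative y \<kappa> t0) (at t0 within I01)"
      using lin_sysD(1)[OF sys[OF \<kappa>] t0] eq0 by simp
    have "\<not> 0 < y \<kappa> t0"
    proof
      assume "0 < y \<kappa> t0"
      from has_real_derivative_pos_inc_left[OF der this]
      obtain d where d: "d > 0" "\<And>h. h > 0 \<Longrightarrow> t0 - h \<in> I01 \<Longrightarrow> h < d \<Longrightarrow> u \<kappa> (t0 - h) < u \<kappa> t0" by blast
      define h where "h = min (d / 2) t0"
      have "h > 0" "h < d" "t0 - h \<in> I01" using d(1) t0pos t0 by (auto simp: h_def)
      then show False using d(2)[of h] ge0[of "t0 - h"] eq0 by auto
    qed
    moreover have "\<not> y \<kappa> t0 < 0"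
    proof
      assume neg: "y \<kappa> t0 < 0"
      then have "t0 \<noteq> 1" using slope[OF \<kappa>] eq0 by auto
      then have t01: "t0 < 1" using t0 by auto
      from has_real_derivative_neg_dec_right[OF der neg]
      obtain d where d: "d > 0" "\<And>h. h > 0 \<Longrightarrow> t0 + h \<in> I01 \<Longrightarrow> h < d \<Longrightarrow> u \<kappa> t0 > u \<kappa> (t0 + h)" by blast
      define h where "h = min (d / 2) (1 - t0)"
      have "h > 0" "h < d" "t0 + h \<in> I01" using d(1) t01 t0 by (auto simp: h_def)
      then show False using d(2)[of h] ge0[of "t0 + h"] eq0 by auto
    qed
    ultimately show False using simple[OF \<kappa> t0 eq0] by simp
  qed
  then show "0 < u l1 t" if "t \<in> I01" for t
    using that l01 by (force simp: Z_def)
  show "0 < y l1 1 - B 1 * u l1 1" using slope l01 by auto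
qed

section \<open>Comparison of the Neumann and mixed Green's functions\<close>

lemma neumann_green_solution:
  assumes a: "a absolutely_integrable_on I01" and G: "is_greens_function a X_N lam G"
    and \<sigma>: "continuous_on I01 \<sigma>"
  obtains w y where "w \<in> X_N" "solves_ae a lam \<sigma> w"
    and "lin_sys (\<lambda>t. integral {0..t} a) lam \<sigma> w y" "y 0 = 0" "y 1 = integral {0..1} a * w 1"
proof -
  define w where "w = (\<lambda>t. LINT s:I01|lebesgue. G t s * \<sigma> s)"
  have w: "w \<in> X_N" "solves_ae a lam \<sigma> w"
    using G absolutely_integrable_continuous_real[OF \<sigma>] by (auto simp: is_greens_function_def w_def)
  then have "w \<in> W21" by (simp add: X_N_def)
  from that[OF w lin_sys_of_solves_ae[OF a this w(2) \<sigma>]] show ?thesis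
    using w(1) by (simp add: X_N_def)
qed

text \<open>Otherwise \<open>u\<close> satisfies both Neumann conditions, and Green's formula against the solution of
  \<open>L w = u\<close> gives \<open>\<integral> u\<^sup>2 = 0\<close>.\<close>

lemma neumann_slope_nonzero:
  assumes a: "a absolutely_integrable_on I01" and G: "is_greens_function a X_N lam G"
    and B: "B = (\<lambda>t. integral {0..t} a)"
    and u: "lin_sys B lam (\<lambda>_. 0) u y" "u 0 = 1" "y 0 = 0"
  shows "y 1 - B 1 * u 1 \<noteq> 0"
proof
  assume z: "y 1 - B 1 * u 1 = 0"
  note cu = lin_sys_continuous(1)[OF u(1)]
  obtain w p where w: "lin_sys B lam u w p" "p 0 = 0" "p 1 = B 1 * w 1"
    using neumann_green_solution[OF a G cu] unfolding B by metis
  have "integral I01 (\<lambda>s. u s * u s - w s * 0) = (u 1 * p 1 - y 1 * w 1) - (u 0 * p 0 - y 0 * w 0)"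
    using greens_formula[OF w(1) u(1), of 0 1] by (intro integral_unique) auto
  then have "integral I01 (\<lambda>s. (u s)\<^sup>2) = 0" using u w z by (simp add: power2_eq_square)
  then show False
    using integral_eq_0_iff[OF continuous_on_power[OF cu, of 2]] u(2) by force
qed

text \<open>The Wronskians of \<open>d\<close> with two independent solutions vanish at \<open>t0\<close>, hence everywhere.\<close>

lemma homogeneous_solution_zero:
  assumes u: "lin_sys B l (\<lambda>_. 0) u y" and v: "lin_sys B l (\<lambda>_. 0) v z"
    and d: "lin_sys B l (\<lambda>_. 0) d p" and W: "u 0 * z 0 - y 0 * v 0 = 1"
    and t0: "t0 \<in> I01" "d t0 = 0" "p t0 = 0" and t: "t \<in> I01"
  shows "d t = 0"
proof -
  have "u t * p t - y t * d t = 0" "v t * p t - z t * d t = 0"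
    using wronskian_constant[OF d u t] wronskian_constant[OF d u t0(1)]
      wronskian_constant[OF d v t] wronskian_constant[OF d v t0(1)] t0 by auto
  moreover have "u t * z t - y t * v t = 1" using wronskian_constant[OF v u t] W by simp
  moreover have "d t * (u t * z t - y t * v t)
      = v t * (u t * p t - y t * d t) - u t * (v t * p t - z t * d t)"
    by (simp add: algebra_simps)
  ultimately show ?thesis by simp
qed

text \<open>A classical solution \<open>u\<close> for the parameter \<open>l\<close> with vanishing slopes at both ends is an
  eigenfunction in \<open>X_N\<close>. Its membership in \<open>W21\<close> and the equation almost everywhere would call
  for Lebesgue's differentiation theorem; instead both are read off from the Green's function at
  \<open>lam\<close>: \<open>u\<close> is a Neumann solution of \<open>L[lam] u = (lam - l) u\<close>, and so is the function \<open>w\<close> that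
  the Green's function produces. Their difference is a homogeneous Neumann solution at \<open>lam\<close>,
  hence \<open>0\<close>.\<close>

lemma eigenvalue_of_neumann_solution:
  assumes a: "a absolutely_integrable_on I01" and G: "is_greens_function a X_N lam G"
    and B: "B = (\<lambda>t. integral {0..t} a)"
    and \<phi>: "lin_sys B lam (\<lambda>_. 0) \<phi> \<phi>q" "\<phi> 0 = 1" "\<phi>q 0 = 0"
    and \<psi>: "lin_sys B lam (\<lambda>_. 0) \<psi> \<psi>q" "\<psi> 0 = 0" "\<psi>q 0 = 1"
    and u: "lin_sys B l (\<lambda>_. 0) u y" "u 0 = 1" "y 0 = 0" "y 1 - B 1 * u 1 = 0"
  shows "is_eigenvalue a X_N l"
proof -
  define \<sigma> where "\<sigma> = (\<lambda>t. (lam - l) * u t)"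
  have us: "lin_sys B lam \<sigma> u y"
    using lin_sys_change_parameter[OF u(1), of lam] by (simp add: \<sigma>_def)
  have c\<sigma>: "continuous_on I01 \<sigma>"
    unfolding \<sigma>_def using lin_sys_continuous(1)[OF u(1)] by (intro continuous_intros)
  obtain w p where w: "w \<in> X_N" "solves_ae a lam \<sigma> w"
    "lin_sys B lam \<sigma> w p" "p 0 = 0" "p 1 = B 1 * w 1"
    using neumann_green_solution[OF a G c\<sigma>] unfolding B by metis
  define d where "d = (\<lambda>t. w t - u t)"
  define dq where "dq = (\<lambda>t. p t - y t)"
  have d: "lin_sys B lam (\<lambda>_. 0) d dq"
    using lin_sys_lincomb[OF w(3) us, of 1 "-1"] by (simp add: d_def dq_def)
  have dq1: "dq 1 = B 1 * d 1" using w(5) u(4) by (simp add: d_def dq_def algebra_simps)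
  \<comment> \<open>The Wronskian of \<open>\<phi>\<close> and \<open>d\<close> is \<open>0\<close> at the left endpoint, since both have slope \<open>0\<close> there.\<close>
  have "\<phi> 1 * dq 1 - \<phi>q 1 * d 1 = 0"
    using wronskian_constant[OF d \<phi>(1), of 1] \<phi> w(4) u(3) by (simp add: dq_def)
  then have "d 1 * (\<phi>q 1 - B 1 * \<phi> 1) = 0" unfolding dq1 by (simp only: algebra_simps)
  then have "d 1 = 0" using neumann_slope_nonzero[OF a G B \<phi>] unfolding mult_eq_0_iff by blast
  then have d0: "d t = 0" if "t \<in> I01" for t
    using homogeneous_solution_zero[OF \<phi>(1) \<psi>(1) d, of 1 t] \<phi> \<psi> dq1 that by simp
  then have wu: "w t = u t" if "t \<in> I01" for t using that by (simp add: d_def)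
  have "solves_ae a l (\<lambda>_. 0) w"
    unfolding solves_ae_def
  proof (rule AE_mp[OF w(2)[unfolded solves_ae_def]], rule AE_I2, rule impI)
    fix t assume "t \<in> space (lebesgue_on I01)"
    then have t: "t \<in> I01" by (simp add: space_restrict_space)
    assume "deriv_I w differentiable (at t within I01) \<and> L_op a lam w t = \<sigma> t"
    then show "deriv_I w differentiable (at t within I01) \<and> L_op a l w t = 0"
      using wu[OF t] by (simp add: L_op_def \<sigma>_def algebra_simps)
  qed
  moreover have "w 0 \<noteq> 0" using wu[of 0] u(2) by simp
  ultimately show ?thesis using w(1) unfolding is_eigenvalue_def by force
qed

theorem corollary3p26:
  fixes a :: "real \<Rightarrow> real" and lam lam0N :: real and G_N G_M2 :: "real \<Rightarrow> real \<Rightarrow> real"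
  assumes "a absolutely_integrable_on I01"
    and "is_first_eigenvalue a X_N lam0N"
    and "lam < lam0N"
    and "is_greens_function a X_N lam G_N"
    and "is_greens_function a X_M2 lam G_M2"
  shows "\<forall>t\<in>{0<..1}. \<forall>s\<in>{0<..1}. G_N t s < G_M2 t s \<and> G_M2 t s < 0"
proof -
  note a = assms(1) and GN = assms(4) and GM = assms(5)
  define B where "B = (\<lambda>t. integral {0..t} a)"
  have B0: "B 0 = 0" by (simp add: B_def)
  have cB: "continuous_on I01 B"
    unfolding B_def using set_lebesgue_integral_eq_integral(1)[OF a] by (rule indefinite_integral_continuous_1)
  have "bounded (B ` I01)" using cB by (intro compact_imp_bounded compact_continuous_image) auto
  then obtain M where M: "\<And>t. t \<in> I01 \<Longrightarrow> \<bar>B t\<bar> \<le> M"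
    unfolding bounded_iff by (metis image_eqI real_norm_def)
  define l0 where "l0 = min lam (- (M + 1) - (2 * M + 1)\<^sup>2)"
  have l0: "l0 \<le> lam" "l0 \<le> - (M + 1) - (2 * M + 1)\<^sup>2" by (auto simp: l0_def)
  obtain U Uq where U: "continuous_on ({l0..lam} \<times> I01) (\<lambda>(l, t). U l t)"
    "continuous_on ({l0..lam} \<times> I01) (\<lambda>(l, t). Uq l t)"
    "\<And>l. l \<in> {l0..lam} \<Longrightarrow> lin_sys B l (\<lambda>_. 0) (U l) (Uq l) \<and> U l 0 = 1 \<and> Uq l 0 = 0"
    using lin_sys_family_exists[OF cB l0(1), of 1 0] by blast
  obtain V Vq where V:
    "\<And>l. l \<in> {l0..lam} \<Longrightarrow> lin_sys B l (\<lambda>_. 0) (V l) (Vq l) \<and> V l 0 = 0 \<and> Vq l 0 = 1"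
    using lin_sys_family_exists[OF cB l0(1), of 0 1] by blast
  have lam: "lam \<in> {l0..lam}" and l0in: "l0 \<in> {l0..lam}" using l0 by auto
  have W: "U l t * Vq l t - Uq l t * V l t = 1" if "l \<in> {l0..lam}" "t \<in> I01" for l t
    using wronskian_constant[of B l "V l" "Vq l" "U l" "Uq l" t] U(3)[OF that(1)] V[OF that(1)] that by simp
  define \<phi> where "\<phi> = U lam" define \<phi>q where "\<phi>q = Uq lam"
  define \<psi> where "\<psi> = V lam" define \<psi>q where "\<psi>q = Vq lam"
  have \<phi>: "lin_sys B lam (\<lambda>_. 0) \<phi> \<phi>q" "\<phi> 0 = 1" "\<phi>q 0 = 0"
    using U(3)[OF lam] by (auto simp: \<phi>_def \<phi>q_def)
  have \<psi>: "lin_sys B lam (\<lambda>_. 0) \<psi> \<psi>q" "\<psi> 0 = 0" "\<psi>q 0 = 1"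
    using V[OF lam] by (auto simp: \<psi>_def \<psi>q_def)
  have W1: "\<phi> t * \<psi>q t - \<phi>q t * \<psi> t = 1" if "t \<in> I01" for t
    using W[OF lam that] by (simp add: \<phi>_def \<phi>q_def \<psi>_def \<psi>q_def)
  have no_eig: "Uq l 1 - B 1 * U l 1 \<noteq> 0" if l: "l \<in> {l0..lam}" for l
  proof
    assume "Uq l 1 - B 1 * U l 1 = 0"
    then have "is_eigenvalue a X_N l"
      using eigenvalue_of_neumann_solution[OF a GN B_def \<phi> \<psi>] U(3)[OF l] by blast
    then show False using assms(2,3) l unfolding is_first_eigenvalue_def by force
  qed
  have simple: "Uq l t \<noteq> 0" if "l \<in> {l0..lam}" "t \<in> I01" "U l t = 0" for l t
    using W[OF that(1,2)] that(3) by auto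
  have start: "\<And>t. t \<in> I01 \<Longrightarrow> 0 < U l0 t" "0 < Uq l0 1 - B 1 * U l0 1"
    using positive_for_very_negative_parameter[of B l0 "U l0" "Uq l0" M] U(3)[OF l0in] M l0(2) by auto
  have Usys: "lin_sys B l (\<lambda>_. 0) (U l) (Uq l)" and U0: "U l 0 = 1" if "l \<in> {l0..lam}" for l
    using U(3)[OF that] by auto
  note cont = positivity_continuation[where B = B and u = U and y = Uq,
      OF l0(1) U(1,2) Usys U0 simple start no_eig]
  have \<phi>pos: "0 < \<phi> t" if "t \<in> I01" for t
    unfolding \<phi>_def by (rule cont(1)) (use that in auto)
  define d\<phi> where "d\<phi> = \<phi>q 1 - B 1 * \<phi> 1"
  define d\<psi> where "d\<psi> = \<psi>q 1 - B 1 * \<psi> 1"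
  have d\<phi>: "0 < d\<phi>"
    unfolding d\<phi>_def \<phi>_def \<phi>q_def by (rule cont(2)) auto
  \<comment> \<open>The numerator is a Wronskian, which is constant: quotients of solutions by \<open>\<phi>\<close> are monotone.\<close>
  have quot: "((\<lambda>t. h t / \<phi> t) has_real_derivative (\<phi> t * hq t - \<phi>q t * h t) / (\<phi> t)\<^sup>2) (at t within I01)"
    if h: "lin_sys B lam (\<lambda>_. 0) h hq" and t: "t \<in> I01" for h hq t
    using lin_sysD(1)[OF h t] lin_sysD(1)[OF \<phi>(1) t] \<phi>pos[OF t]
    by (auto intro!: derivative_eq_intros simp: field_simps power2_eq_square)
  have \<psi>pos: "0 < \<psi> t" if t: "t \<in> {0<..1}" for t
  proof -
    have "\<psi> 0 / \<phi> 0 < \<psi> t / \<phi> t"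
      by (rule strict_mono_of_deriv_pos[of 0 1 _ "\<lambda>t. 1 / (\<phi> t)\<^sup>2"])
         (use quot[OF \<psi>(1)] W1 \<phi>pos t in \<open>auto simp: zero_less_power less_imp_neq[symmetric]\<close>)
    then show ?thesis using \<psi>(2) \<phi>pos[of t] t by (simp add: zero_less_divide_iff)
  qed
  have d\<psi>: "0 < d\<psi>"
  proof -
    have "\<phi> 1 * d\<psi> = 1 + d\<phi> * \<psi> 1" using W1[of 1] by (simp add: d\<phi>_def d\<psi>_def algebra_simps)
    also have "\<dots> > 0" using d\<phi> \<psi>pos[of 1] by (simp add: add_pos_pos)
    finally show ?thesis using \<phi>pos[of 1] by (simp add: zero_less_mult_iff)
  qed
  \<comment> \<open>The solution with \<open>v(1) = 1\<close> and \<open>v'(1) = 0\<close>.\<close>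
  define v where "v = (\<lambda>t. d\<psi> * \<phi> t + (- d\<phi>) * \<psi> t)"
  define vq where "vq = (\<lambda>t. d\<psi> * \<phi>q t + (- d\<phi>) * \<psi>q t)"
  have v: "lin_sys B lam (\<lambda>_. 0) v vq"
    using lin_sys_lincomb[OF \<phi>(1) \<psi>(1), of d\<psi> "- d\<phi>"] by (simp add: v_def vq_def)
  have v1: "v 1 = 1" and vq1: "vq 1 = B 1"
    using W1[of 1] by (simp_all add: v_def vq_def d\<phi>_def d\<psi>_def algebra_simps)
  have w\<phi>: "\<phi> t * vq t - \<phi>q t * v t = - d\<phi>" and w\<psi>: "\<psi> t * vq t - \<psi>q t * v t = - d\<psi>"
    if t: "t \<in> I01" for t
  proof -
    have "\<phi> t * vq t - \<phi>q t * v t = - d\<phi> * (\<phi> t * \<psi>q t - \<phi>q t * \<psi> t)"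
      "\<psi> t * vq t - \<psi>q t * v t = - d\<psi> * (\<phi> t * \<psi>q t - \<phi>q t * \<psi> t)"
      by (simp_all add: v_def vq_def algebra_simps)
    then show "\<phi> t * vq t - \<phi>q t * v t = - d\<phi>" "\<psi> t * vq t - \<psi>q t * v t = - d\<psi>"
      by (simp_all add: W1[OF t])
  qed
  have vpos: "0 < v t" if t: "t \<in> I01" for t
  proof -
    have "- (v t / \<phi> t) \<le> - (v 1 / \<phi> 1)"
    proof (rule mono_of_deriv_nonneg[of 0 1 "\<lambda>t. - (v t / \<phi> t)" "\<lambda>t. d\<phi> / (\<phi> t)\<^sup>2"])
      fix x :: real assume x: "x \<in> I01"
      show "((\<lambda>t. - (v t / \<phi> t)) has_real_derivative d\<phi> / (\<phi> x)\<^sup>2) (at x within I01)"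
        by (rule DERIV_cong[OF DERIV_minus[OF quot[OF v x]]]) (simp add: w\<phi>[OF x])
    qed (use d\<phi> t in auto)
    moreover have "0 < v 1 / \<phi> 1" using v1 \<phi>pos[of 1] by simp
    ultimately have "0 < v t / \<phi> t" by linarith
    then show ?thesis using \<phi>pos[OF t] by (simp add: zero_less_divide_iff)
  qed
  have XW: "X_N \<subseteq> W21" "X_M2 \<subseteq> W21" by (auto simp: X_N_def X_M2_def)
  have kN: "G_N t s = (if s \<le> t then v t * \<phi> s else \<phi> t * v s) / (- d\<phi>)" if "t \<in> I01" "s \<in> I01" for t s
    by (rule greens_function_eq[OF a GN XW(1) B_def \<phi>(1) v w\<phi>])
       (use that d\<phi> \<phi> v1 vq1 in \<open>auto simp: X_N_def\<close>)
  have kM: "G_M2 t s = (if s \<le> t then v t * \<psi> s else \<psi> t * v s) / (- d\<psi>)" if "t \<in> I01" "s \<in> I01" for t s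
    by (rule greens_function_eq[OF a GM XW(2) B_def \<psi>(1) v w\<psi>])
       (use that d\<psi> \<psi> v1 vq1 in \<open>auto simp: X_M2_def\<close>)
  show ?thesis
  proof (intro ballI)
    fix t s :: real assume ts: "t \<in> {0<..1}" "s \<in> {0<..1}"
    then have tsI: "t \<in> I01" "s \<in> I01" by auto
    \<comment> \<open>Both kernels are symmetric, so they depend on \<open>min s t\<close> and \<open>max s t\<close> only.\<close>
    define m where "m = min s t"
    define n where "n = max s t"
    have mn: "m \<in> {0<..1}" "m \<in> I01" "n \<in> I01" using ts by (auto simp: m_def n_def)
    have N: "G_N t s = - (v n * \<phi> m / d\<phi>)" and M2: "G_M2 t s = - (v n * \<psi> m / d\<psi>)"
      using kN[OF tsI] kM[OF tsI] by (auto simp: m_def n_def)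
    have vm: "v m = d\<psi> * \<phi> m - d\<phi> * \<psi> m" by (simp add: v_def)
    \<comment> \<open>The difference of \<open>\<phi> / d\<phi>\<close> and \<open>\<psi> / d\<psi>\<close> is again a multiple of \<open>v\<close>.\<close>
    have "G_M2 t s - G_N t s = v n * v m / (d\<phi> * d\<psi>)"
      unfolding N M2 vm using d\<phi> d\<psi> by (simp add: field_simps)
    also have "\<dots> > 0" using vpos mn d\<phi> d\<psi> by simp
    finally have "G_N t s < G_M2 t s" by simp
    moreover have "G_M2 t s < 0" unfolding M2 using vpos mn \<psi>pos d\<psi> by simp
    ultimately show "G_N t s < G_M2 t s \<and> G_M2 t s < 0" by simp
  qed
qed

end
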